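(* Suppose a spacetime $(N^4,\overline g)$ admits a coordinate chart $\{t,r,\theta,\phi\}$ in which, in the order $(t,r,\theta,\phi)$, $$\overline g=\begin{pmatrix}-v^2&d&e&f\\ d&u^2&0&0\\ e&0&a&c\\ f&0&c&b\end{pmatrix},\qquad ab-c^2=r^4\sin^2\theta,$$ with smooth functions $a,b,c,d,e,f,u,v$. Then $e_r:=\frac1u\frac{\partial}{\partial r}$ is straight out (on every coordinate sphere $S_{t,r}$) if and only if $d$ satisfies the second order elliptic PDE in $d$ on the coordinate spheres $$\Delta_{g_S}d+G(d,d')=0,\qquad G:=\frac{F}{r^4\sin^2\theta},$$ where $g_S$ is the induced metric on $S_{t,r}$, $\Delta_{g_S}$ its Laplacian, $|\overline g|=\det\overline g$, subscripts after commas denote coordinate derivatives, and $$\begin{aligned} F={}&(be_{,r\theta}-cf_{,r\theta}-ce_{,r\phi}+af_{,r\phi})-\tfrac{d}{u^2}\big(b(u^2)_{,\theta\theta}-2c(u^2)_{,\theta\phi}+a(u^2)_{,\phi\phi}\big)\\ &+\tfrac{cf-be}{ab-c^2}(ba_{,r\theta}-cc_{,r\theta}-ca_{,r\phi}+ac_{,r\phi})+\tfrac{ce-af}{ab-c^2}(bc_{,r\theta}-cb_{,r\theta}-cc_{,r\phi}+ab_{,r\phi})\\ &+\cot\theta\,(bd_{,\theta}-cd_{,\phi})-\tfrac{|\overline g|_{,\theta}}{2|\overline g|}(be_{,r}+bd_{,\theta}-cf_{,r}-cd_{,\phi})-\tfrac{|\overline g|_{,\phi}}{2|\overline g|}(-ce_{,r}-cd_{,\theta}+af_{,r}+ad_{,\phi})\\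 &-\tfrac2u\Big[\big(d_{,\theta}-\tfrac{2d\,u_{,\theta}}{u}-\tfrac{d\,|\overline g|_{,\theta}}{2|\overline g|}\big)(bu_{,\theta}-cu_{,\phi})+\big(d_{,\phi}-\tfrac{2d\,u_{,\phi}}{u}-\tfrac{d\,|\overline g|_{,\phi}}{2|\overline g|}\big)(-cu_{,\theta}+au_{,\phi})\Big]\\ &+\tfrac{1}{ab-c^2}\Big[\big((cf-be)_{,\theta}-(cf-be)(\tfrac{|\overline g|_{,\theta}}{2|\overline g|}+2\cot\theta)\big)(ba_{,r}-cc_{,r})+\big((cf-be)_{,\phi}-(cf-be)\tfrac{|\overline g|_{,\phi}}{2|\overline g|}\big)(-ca_{,r}+ac_{,r})\Big]\\ &+\tfrac{1}{ab-c^2}\Big[\big((ce-af)_{,\theta}-(ce-af)(\tfrac{|\overline g|_{,\theta}}{2|\overline g|}+2\cot\theta)\big)(bc_{,r}-cb_{,r})+\big((ce-af)_{,\phi}-(ce-af)\tfrac{|\overline g|_{,\phi}}{2|\overline g|}\big)(-cc_{,r}+ab_{,r})\Big]\\ &+(b_{,\theta}e_{,r}-c_{,\phi}e_{,r}-c_{,\theta}f_{,r}+a_{,\phi}f_{,r})-\tfrac{2d}{u}(b_{,\theta}u_{,\theta}-c_{,\phi}u_{,\theta}-c_{,\theta}u_{,\phi}+a_{,\phi}u_{,\phi})\\ &+\tfrac{cf-be}{ab-c^2}(b_{,\theta}a_{,r}-a_{,r}c_{,\phi}-c_{,r}c_{,\theta}+a_{,\phi}c_{,r})+\tfrac{ce-af}{ab-c^2}(b_{,\theta}c_{,r}-c_{,r}c_{,\phi}-b_{,r}c_{,\theta}+a_{,\phi}b_{,r}).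 \end{aligned}$$
   Context: A spacetime is a connected, smooth, time-oriented Lorentzian 4-manifold of signature $(-,+,+,+)$ with Levi-Civita connection $\overline\nabla$. $S_{t,r}$ is the coordinate sphere ($t,r$ constant), spacelike, with induced metric $g_S=a\,d\theta^2+2c\,d\theta\,d\phi+b\,d\phi^2$; $u>0$; $\partial_r$ is outward spacelike; all expressions are in the coordinate domain, where $\sin\theta\neq0$. On the rank-two normal bundle of $S_{t,r}$ let $\nabla^\perp$ be the projection of $\overline\nabla$. For an outward-spacelike unit normal field $\nu$, $\nu^\perp$ denotes the future-timelike unit normal field orthogonal to $\nu$. In particular $e_r^\perp$ is the future-timelike unit normal to $S_{t,r}$ orthogonal to $\partial_r$. The connection one-form of $\nu$ is $\alpha_\nu(X)=\langle\nabla^\perp_X\nu,\nu^\perp\rangle_{\overline g}$ for $X$ tangent to $S_{t,r}$. The field $e_r$ is called straight out on $S_{t,r}$ if $\mathrm{div}_{g_S}\alpha_{e_r}=0$, where the divergence of a one-form is that of the $g_S$-dual vector field. The symbol $d'$ stands for the first derivatives of $d$; all the other functions entering $G$ are regarded as given coefficients. *)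

theory Defs
  imports "HOL-Analysis.Analysis"
begin

section \<open>Smooth functions and partial derivatives\<close>

text \<open>On an open set, all iterated directional derivatives up to order \<open>n\<close> exist and are
  continuous.\<close>

fun Ck_on :: "nat \<Rightarrow> 'a::real_normed_vector set \<Rightarrow> ('a \<Rightarrow> 'b::real_normed_vector) \<Rightarrow> bool" where
  "Ck_on 0 S f \<longleftrightarrow> continuous_on S f"
| "Ck_on (Suc n) S f \<longleftrightarrow> (\<forall>p\<in>S. f differentiable (at p)) \<and>
     (\<forall>w. Ck_on n S (\<lambda>p. frechet_derivative f (at p) w))"

definition smooth_on :: "'a::real_normed_vector set \<Rightarrow> ('a \<Rightarrow> 'b::real_normed_vector) \<Rightarrow> bool" where
  "smooth_on S f \<longleftrightarrow> (\<forall>n. Ck_on n S f)"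

definition pd :: "'n::finite \<Rightarrow> (real^'n \<Rightarrow> real) \<Rightarrow> real^'n \<Rightarrow> real" where
  "pd i f p = frechet_derivative f (at p) (axis i 1)"


section \<open>Pseudo-Riemannian calculus in a coordinate domain\<close>

text \<open>Metrics, vector fields and one-forms are given by their components with respect to the
  coordinate frame; \<open>h p\<close> is the Gram matrix of the metric at \<open>p\<close>.\<close>

definition ip :: "real^'n^'n \<Rightarrow> real^'n \<Rightarrow> real^'n \<Rightarrow> real" where
  "ip A X Y = X \<bullet> (A *v Y)"

text \<open>Christoffel symbols \<open>\<Gamma>\<^sup>k\<^sub>i\<^sub>j\<close> of the Levi-Civita connection.\<close>

definition christoffel :: "(real^'n \<Rightarrow> real^'n^'n) \<Rightarrow> 'n::finite \<Rightarrow> 'n \<Rightarrow> 'n \<Rightarrow> real^'n \<Rightarrow> real" where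
  "christoffel h k i j p = (\<Sum>l\<in>UNIV. matrix_inv (h p) $ k $ l *
     (pd i (\<lambda>q. h q $ j $ l) p + pd j (\<lambda>q. h q $ i $ l) p - pd l (\<lambda>q. h q $ i $ j) p)) / 2"

definition cov_deriv ::
    "(real^'n \<Rightarrow> real^'n^'n) \<Rightarrow> real^'n \<Rightarrow> (real^'n \<Rightarrow> real^'n) \<Rightarrow> real^'n::finite \<Rightarrow> real^'n" where
  "cov_deriv h X Y p = (\<chi> k. \<Sum>i\<in>UNIV. X $ i *
     (pd i (\<lambda>q. Y q $ k) p + (\<Sum>j\<in>UNIV. christoffel h k i j p * Y p $ j)))"

definition div_vec :: "(real^'n \<Rightarrow> real^'n^'n) \<Rightarrow> (real^'n \<Rightarrow> real^'n) \<Rightarrow> real^'n::finite \<Rightarrow> real" where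
  "div_vec h V p = (\<Sum>k\<in>UNIV. cov_deriv h (axis k 1) V p $ k)"

definition div_form :: "(real^'n \<Rightarrow> real^'n^'n) \<Rightarrow> (real^'n \<Rightarrow> real^'n) \<Rightarrow> real^'n::finite \<Rightarrow> real" where
  "div_form h \<alpha> = div_vec h (\<lambda>p. matrix_inv (h p) *v \<alpha> p)"

definition laplacian :: "(real^'n \<Rightarrow> real^'n^'n) \<Rightarrow> (real^'n \<Rightarrow> real) \<Rightarrow> real^'n::finite \<Rightarrow> real" where
  "laplacian h w = div_form h (\<lambda>p. \<chi> i. pd i w p)"


section \<open>Spacetimes\<close>

definition minkowski :: "real^4^4" where
  "minkowski = (\<chi> i j. if i \<noteq> j then 0 else if i = 1 then - 1 else 1)"

definition lorentzian_form :: "real^4^4 \<Rightarrow> bool" where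
  "lorentzian_form A \<longleftrightarrow> transpose A = A \<and>
     (\<exists>P. invertible P \<and> transpose P ** A ** P = minkowski)"

text \<open>A chart is a pair of an open set and a coordinate map.\<close>

type_synonym 'p chart = "'p set \<times> ('p \<Rightarrow> real^4)"

definition transition :: "'p chart \<Rightarrow> 'p chart \<Rightarrow> real^4 \<Rightarrow> real^4" where
  "transition c c' = snd c' \<circ> inv_into (fst c) (snd c)"

definition jacobian_at :: "(real^4 \<Rightarrow> real^4) \<Rightarrow> real^4 \<Rightarrow> real^4^4" where
  "jacobian_at \<psi> p = matrix (frechet_derivative \<psi> (at p))"

text \<open>A tensor field is a family of component functions, one for each chart of the atlas, obeying
  the transformation law. Here \<open>g\<close> is the metric, and the time orientation is given by a continuous
  timelike vector field \<open>T\<close>, which is declared to be future-directed.\<close>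

locale spacetime =
  fixes M :: "'p topology"
    and A :: "'p chart set"
    and g :: "'p chart \<Rightarrow> real^4 \<Rightarrow> real^4^4"
    and T :: "'p chart \<Rightarrow> real^4 \<Rightarrow> real^4"
  assumes nonempty: "topspace M \<noteq> {}"
    and hausdorff: "Hausdorff_space M"
    and second_countable: "second_countable M"
    and connected: "connected_space M"
    and chart: "(U, x) \<in> A \<Longrightarrow> openin M U \<and> open (x ` U) \<and>
      homeomorphic_map (subtopology M U) (top_of_set (x ` U)) x"
    and cover: "\<Union> (fst ` A) = topspace M"
    and smooth_transition: "(U, x) \<in> A \<Longrightarrow> (V, y) \<in> A \<Longrightarrow>
      smooth_on (x ` (U \<inter> V)) (transition (U, x) (V, y))"
    and metric_smooth: "(U, x) \<in> A \<Longrightarrow> smooth_on (x ` U) (\<lambda>p. g (U, x) p $ i $ j)"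
    and metric_lorentzian: "(U, x) \<in> A \<Longrightarrow> p \<in> x ` U \<Longrightarrow> lorentzian_form (g (U, x) p)"
    and metric_tensor: "(U, x) \<in> A \<Longrightarrow> (V, y) \<in> A \<Longrightarrow> p \<in> x ` (U \<inter> V) \<Longrightarrow>
      g (U, x) p =
        transpose (jacobian_at (transition (U, x) (V, y)) p) **
        g (V, y) (transition (U, x) (V, y) p) ** jacobian_at (transition (U, x) (V, y)) p"
    and time_continuous: "(U, x) \<in> A \<Longrightarrow> continuous_on (x ` U) (T (U, x))"
    and time_timelike: "(U, x) \<in> A \<Longrightarrow> p \<in> x ` U \<Longrightarrow> ip (g (U, x) p) (T (U, x) p) (T (U, x) p) < 0"
    and time_vector: "(U, x) \<in> A \<Longrightarrow> (V, y) \<in> A \<Longrightarrow> p \<in> x ` (U \<inter> V) \<Longrightarrow>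
      T (V, y) (transition (U, x) (V, y) p) = jacobian_at (transition (U, x) (V, y)) p *v T (U, x) p"

definition future_timelike :: "real^4^4 \<Rightarrow> real^4 \<Rightarrow> real^4 \<Rightarrow> bool" where
  "future_timelike A \<tau> w \<longleftrightarrow> ip A w w < 0 \<and> ip A w \<tau> < 0"


section \<open>Coordinate spheres and their normal bundle\<close>

text \<open>The coordinates \<open>(t, r, \<theta>, \<phi>)\<close> are the components \<open>1, 2, 3, 4\<close> of a point of \<open>\<real>\<^sup>4\<close>; \<open>(\<theta>, \<phi>)\<close>
  are the components \<open>1, 2\<close> of a point of \<open>\<real>\<^sup>2\<close>, which serve as coordinates on \<open>S\<^sub>t\<^sub>,\<^sub>r\<close>.
  The set \<open>D\<close> is the image of the chart.\<close>

definition sphere_pt :: "real \<Rightarrow> real \<Rightarrow> real^2 \<Rightarrow> real^4" where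
  "sphere_pt t r q = vector [t, r, q $ 1, q $ 2]"

definition coord_sphere :: "(real^4) set \<Rightarrow> real \<Rightarrow> real \<Rightarrow> (real^2) set" where
  "coord_sphere D t r = {q. sphere_pt t r q \<in> D}"

text \<open>The differential of \<^term>\<open>sphere_pt t r\<close>.\<close>

definition sphere_push :: "real^2 \<Rightarrow> real^4" where
  "sphere_push X = vector [0, 0, X $ 1, X $ 2]"

definition induced_metric :: "(real^4 \<Rightarrow> real^4^4) \<Rightarrow> real \<Rightarrow> real \<Rightarrow> real^2 \<Rightarrow> real^2^2" where
  "induced_metric g t r q =
     (\<chi> i j. ip (g (sphere_pt t r q)) (sphere_push (axis i 1)) (sphere_push (axis j 1)))"

definition spacelike_sphere :: "(real^4 \<Rightarrow> real^4^4) \<Rightarrow> (real^4) set \<Rightarrow> real \<Rightarrow> real \<Rightarrow> bool" where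
  "spacelike_sphere g D t r \<longleftrightarrow> (\<forall>q \<in> coord_sphere D t r. \<forall>X. X \<noteq> 0 \<longrightarrow>
     ip (induced_metric g t r q) X X > 0)"

definition sphere_tangent :: "real^4 \<Rightarrow> bool" where
  "sphere_tangent X \<longleftrightarrow> X \<in> range sphere_push"

definition sphere_normal :: "real^4^4 \<Rightarrow> real^4 \<Rightarrow> bool" where
  "sphere_normal A w \<longleftrightarrow> (\<forall>X. sphere_tangent X \<longrightarrow> ip A w X = 0)"

definition normal_proj :: "real^4^4 \<Rightarrow> real^4 \<Rightarrow> real^4" where
  "normal_proj A Y = (THE w. sphere_normal A w \<and> sphere_tangent (Y - w))"

definition normal_connection ::
    "(real^4 \<Rightarrow> real^4^4) \<Rightarrow> real^4 \<Rightarrow> (real^4 \<Rightarrow> real^4) \<Rightarrow> real^4 \<Rightarrow> real^4" where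
  "normal_connection g X \<nu> p = normal_proj (g p) (cov_deriv g X \<nu> p)"

text \<open>\<open>\<nu>\<^sup>\<bottom>\<close>, where \<open>T\<close> is the time orientation.\<close>

definition normal_perp ::
    "(real^4 \<Rightarrow> real^4^4) \<Rightarrow> (real^4 \<Rightarrow> real^4) \<Rightarrow> (real^4 \<Rightarrow> real^4) \<Rightarrow> real^4 \<Rightarrow> real^4" where
  "normal_perp g T \<nu> p = (THE w. sphere_normal (g p) w \<and> ip (g p) w w = - 1 \<and>
     ip (g p) w (\<nu> p) = 0 \<and> future_timelike (g p) (T p) w)"

definition connection_form ::
    "(real^4 \<Rightarrow> real^4^4) \<Rightarrow> (real^4 \<Rightarrow> real^4) \<Rightarrow> (real^4 \<Rightarrow> real^4) \<Rightarrow> real^4 \<Rightarrow> real^4 \<Rightarrow> real" where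
  "connection_form g T \<nu> p X = ip (g p) (normal_connection g X \<nu> p) (normal_perp g T \<nu> p)"

definition sphere_connection_form :: "(real^4 \<Rightarrow> real^4^4) \<Rightarrow> (real^4 \<Rightarrow> real^4) \<Rightarrow>
    (real^4 \<Rightarrow> real^4) \<Rightarrow> real \<Rightarrow> real \<Rightarrow> real^2 \<Rightarrow> real^2" where
  "sphere_connection_form g T \<nu> t r q =
     (\<chi> i. connection_form g T \<nu> (sphere_pt t r q) (sphere_push (axis i 1)))"

definition straight_out :: "(real^4 \<Rightarrow> real^4^4) \<Rightarrow> (real^4 \<Rightarrow> real^4) \<Rightarrow> (real^4) set \<Rightarrow>
    (real^4 \<Rightarrow> real^4) \<Rightarrow> real \<Rightarrow> real \<Rightarrow> bool" where
  "straight_out g T D \<nu> t r \<longleftrightarrow> (\<forall>q \<in> coord_sphere D t r.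
     div_form (induced_metric g t r) (sphere_connection_form g T \<nu> t r) q = 0)"

text \<open>Normal to the spheres and of unit length for metrics of the form \<open>gbar\<close> below.\<close>

definition e_r :: "(real^4 \<Rightarrow> real) \<Rightarrow> real^4 \<Rightarrow> real^4" where
  "e_r u p = (1 / u p) *\<^sub>R axis 2 1"


section \<open>The metric and the equation for \<open>d\<close>\<close>

type_synonym fn4 = "real^4 \<Rightarrow> real"

definition gbar :: "fn4 \<Rightarrow> fn4 \<Rightarrow> fn4 \<Rightarrow> fn4 \<Rightarrow> fn4 \<Rightarrow> fn4 \<Rightarrow> fn4 \<Rightarrow> fn4 \<Rightarrow> real^4 \<Rightarrow> real^4^4" where
  "gbar a b c d e f u v p = vector
     [vector [- (v p)\<^sup>2, d p, e p, f p],
      vector [d p, (u p)\<^sup>2, 0, 0],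
      vector [e p, 0, a p, c p],
      vector [f p, 0, c p, b p]]"

abbreviation Dr :: "fn4 \<Rightarrow> fn4" where "Dr \<equiv> pd 2"
abbreviation Dth :: "fn4 \<Rightarrow> fn4" where "Dth \<equiv> pd 3"
abbreviation Dph :: "fn4 \<Rightarrow> fn4" where "Dph \<equiv> pd 4"

text \<open>Half the logarithmic derivative \<open>|g|\<^sub>,\<^sub>i / (2 |g|)\<close> of the determinant.\<close>

definition hld :: "4 \<Rightarrow> (real^4 \<Rightarrow> real^4^4) \<Rightarrow> fn4" where
  "hld i g p = pd i (\<lambda>q. det (g q)) p / (2 * det (g p))"

definition F_term :: "fn4 \<Rightarrow> fn4 \<Rightarrow> fn4 \<Rightarrow> fn4 \<Rightarrow> fn4 \<Rightarrow> fn4 \<Rightarrow> fn4 \<Rightarrow> fn4 \<Rightarrow> fn4" where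
  "F_term a b c d e f u v p =
    (let
       u2 = (\<lambda>q. (u q)\<^sup>2);
       m = a p * b p - (c p)\<^sup>2;
       k = (\<lambda>q. c q * f q - b q * e q);
       l = (\<lambda>q. c q * e q - a q * f q);
       Lth = hld 3 (gbar a b c d e f u v) p;
       Lph = hld 4 (gbar a b c d e f u v) p;
       cot\<theta> = cot (p $ 3)
     in
       (b p * Dth (Dr e) p - c p * Dth (Dr f) p - c p * Dph (Dr e) p + a p * Dph (Dr f) p)
     - d p / (u p)\<^sup>2 *
         (b p * Dth (Dth u2) p - 2 * c p * Dph (Dth u2) p + a p * Dph (Dph u2) p)
     + k p / m *
         (b p * Dth (Dr a) p - c p * Dth (Dr c) p - c p * Dph (Dr a) p + a p * Dph (Dr c) p)
     + l p / m *
         (b p * Dth (Dr c) p - c p * Dth (Dr b) p - c p * Dph (Dr c) p + a p * Dph (Dr b) p)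
     + cot\<theta> * (b p * Dth d p - c p * Dph d p)
     - Lth * (b p * Dr e p + b p * Dth d p - c p * Dr f p - c p * Dph d p)
     - Lph * (- c p * Dr e p - c p * Dth d p + a p * Dr f p + a p * Dph d p)
     - 2 / u p *
         ((Dth d p - 2 * d p * Dth u p / u p - d p * Lth) * (b p * Dth u p - c p * Dph u p)
        + (Dph d p - 2 * d p * Dph u p / u p - d p * Lph) * (- c p * Dth u p + a p * Dph u p))
     + 1 / m *
         ((Dth k p - k p * (Lth + 2 * cot\<theta>)) * (b p * Dr a p - c p * Dr c p)
        + (Dph k p - k p * Lph) * (- c p * Dr a p + a p * Dr c p))
     + 1 / m *
         ((Dth l p - l p * (Lth + 2 * cot\<theta>)) * (b p * Dr c p - c p * Dr b p)
        + (Dph l p - l p * Lph) * (- c p * Dr c p + a p * Dr b p))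
     + (Dth b p * Dr e p - Dph c p * Dr e p - Dth c p * Dr f p + Dph a p * Dr f p)
     - 2 * d p / u p *
         (Dth b p * Dth u p - Dph c p * Dth u p - Dth c p * Dph u p + Dph a p * Dph u p)
     + k p / m *
         (Dth b p * Dr a p - Dr a p * Dph c p - Dr c p * Dth c p + Dph a p * Dr c p)
     + l p / m *
         (Dth b p * Dr c p - Dr c p * Dph c p - Dr b p * Dth c p + Dph a p * Dr b p))"

definition G_term :: "fn4 \<Rightarrow> fn4 \<Rightarrow> fn4 \<Rightarrow> fn4 \<Rightarrow> fn4 \<Rightarrow> fn4 \<Rightarrow> fn4 \<Rightarrow> fn4 \<Rightarrow> fn4" where
  "G_term a b c d e f u v p = F_term a b c d e f u v p / ((p $ 2) ^ 4 * (sin (p $ 3))\<^sup>2)"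

text \<open>The operator \<open>w \<mapsto> \<Delta> w + G(w, w')\<close> on \<open>S\<^sub>t\<^sub>,\<^sub>r\<close> with metric \<open>h t r\<close>. In the determinant entering
  \<^const>\<open>G_term\<close> the component \<open>d\<close> is replaced by \<open>w\<close> as well.\<close>

definition straight_out_operator :: "(real \<Rightarrow> real \<Rightarrow> real^2 \<Rightarrow> real^2^2) \<Rightarrow>
    fn4 \<Rightarrow> fn4 \<Rightarrow> fn4 \<Rightarrow> fn4 \<Rightarrow> fn4 \<Rightarrow> fn4 \<Rightarrow> fn4 \<Rightarrow> fn4 \<Rightarrow> real \<Rightarrow> real \<Rightarrow> real^2 \<Rightarrow> real" where
  "straight_out_operator h a b c e f u v w t r q =
     laplacian (h t r) (\<lambda>q. w (sphere_pt t r q)) q + G_term a b c w e f u v (sphere_pt t r q)"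

text \<open>\<open>P\<close> is a (semilinear) second order elliptic operator on the coordinate spheres: its principal
  part is \<open>C\<^sup>i\<^sup>j \<partial>\<^sub>i\<partial>\<^sub>j\<close> with \<open>C\<close> positive definite, and the rest depends only on the point, the unknown
  and its first derivatives along the sphere.\<close>

definition second_order_elliptic_on_spheres ::
    "(real^4) set \<Rightarrow> (fn4 \<Rightarrow> real \<Rightarrow> real \<Rightarrow> real^2 \<Rightarrow> real) \<Rightarrow> bool" where
  "second_order_elliptic_on_spheres D P \<longleftrightarrow>
    (\<exists>(C :: real^4 \<Rightarrow> real^2^2) (B :: real^4 \<Rightarrow> real \<Rightarrow> real^2 \<Rightarrow> real).
      (\<forall>p\<in>D. \<forall>\<xi>. \<xi> \<noteq> 0 \<longrightarrow> ip (C p) \<xi> \<xi> > 0) \<and>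
      (\<forall>w. smooth_on D w \<longrightarrow> (\<forall>t r. \<forall>q \<in> coord_sphere D t r.
         let p = sphere_pt t r q; ws = (\<lambda>q. w (sphere_pt t r q)) in
         P w t r q = (\<Sum>i\<in>UNIV. \<Sum>j\<in>UNIV. C p $ i $ j * pd i (pd j ws) q)
           + B p (w p) (\<chi> i. pd i ws q))))"

end

theory Submission
  imports Defs
begin

text \<open>The field \<open>e_r = \<partial>\<^sub>r / u\<close> is straight out if a certain one-form \<open>\<alpha>\<close> on the spheres has divergence zero, and
  the proof computes \<open>\<alpha>\<close> and its divergence in the coordinates.

  The unit normal orthogonal to \<open>e_r\<close> is orthogonal to \<open>\<partial>\<^sub>r\<close>, \<open>\<partial>\<^sub>\<theta>\<close> and \<open>\<partial>\<^sub>\<phi>\<close>, so its dual one-form is a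
  multiple of \<open>dt\<close>. Hence \<open>\<alpha>\<close> only sees the Christoffel symbols \<open>\<Gamma>\<^sup>t\<^sub>i\<^sub>r\<close> with \<open>i = \<theta>, \<phi>\<close>. They involve the
  row \<open>g\<^sup>t\<^sup>\<mu>\<close> of the inverse metric, which is proportional to \<open>(1, - d / u\<^sup>2, k / m, l / m)\<close> with
  \<open>m = a b - c\<^sup>2\<close>, \<open>k = c f - b e\<close> and \<open>l = c e - a f\<close>. The result is
  \<open>\<alpha> = \<plusminus> (1/2) \<rho> \<beta>\<close> with \<open>\<rho> = sqrt (m / \<bar>det g\<bar>)\<close> and a one-form \<open>\<beta>\<close> whose components
  \<open>\<beta>\<^sub>i = d\<^sub>,\<^sub>i + \<dots>\<close> contain no square root (\<open>connection_form_e_r\<close>). The sign is that of the time component of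
  the time orientation, which is continuous and never zero, hence locally constant.

  Since \<open>\<surd>m = r\<^sup>2 \<bar>sin \<theta>\<bar>\<close>, the logarithmic derivatives of \<open>\<surd>m\<close> are \<open>cot \<theta>\<close> and \<open>0\<close>, and
  \<open>m div \<omega> = \<partial>\<^sub>\<theta> n\<^sub>\<theta> + \<partial>\<^sub>\<phi> n\<^sub>\<phi> - cot \<theta> n\<^sub>\<theta>\<close>, where \<open>n / m\<close> is the vector field dual to \<open>\<omega>\<close>
  (\<open>div_form_on_sphere\<close>). For \<open>\<omega> = \<alpha>\<close> the derivatives of \<open>\<rho>\<close> cancel the cotangent and bring in the
  logarithmic derivatives of \<open>det g\<close>; if \<open>\<omega>\<close> is the differential of \<open>d\<close>, the same formula is the Laplacian.
  Comparing the two gives \<open>div \<alpha> = \<plusminus> (1/2) \<rho> (\<Delta>d + G)\<close> (\<open>divergence_identity\<close>,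
  \<open>div_connection_form\<close>), and \<open>\<rho> > 0\<close> yields the equivalence.

  For ellipticity, \<open>G\<close> depends on the unknown only through its value and its first derivatives along the
  sphere (\<open>F_term_cong_jet\<close>), so the principal part of the equation is that of the Laplacian.\<close>


section \<open>Partial derivatives\<close>

lemma pd_eqI: "(f has_derivative f') (at p) \<Longrightarrow> pd i f p = f' (axis i 1)"
  unfolding pd_def using frechet_derivative_at by metis

text \<open>The Frechet derivative is chosen among all maps that are a derivative at \<open>p\<close>. Functions that agree
  near \<open>p\<close> have the same such maps, possibly none, so the same one is chosen.\<close>

lemma pd_cong:
  assumes "open S" "p \<in> S" "\<And>q. q \<in> S \<Longrightarrow> f q = g q"
  shows "pd i f p = pd i g p"
proof -
  have "(f has_derivative f') (at p) \<longleftrightarrow> (g has_derivative f') (at p)" for f'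
    using has_derivative_transform_within_open[OF _ assms(1,2), of f f' UNIV g]
      has_derivative_transform_within_open[OF _ assms(1,2), of g f' UNIV f] assms(3) by auto
  then show ?thesis
    unfolding pd_def frechet_derivative_def by simp
qed

lemma pd_const: "pd i (\<lambda>q. k) p = 0"
  by (rule pd_eqI[THEN trans]) (rule has_derivative_const, simp)

lemma has_derivative_pd:
  "f differentiable at p \<Longrightarrow> (f has_derivative frechet_derivative f (at p)) (at p)"
  by (simp add: frechet_derivative_works)

lemma pd_add:
  "f differentiable at p \<Longrightarrow> g differentiable at p \<Longrightarrow>
    pd i (\<lambda>q. f q + g q) p = pd i f p + pd i g p"
  using pd_eqI[OF has_derivative_add[OF has_derivative_pd has_derivative_pd]]
  by (simp add: pd_def)

lemma pd_diff:
  "f differentiable at p \<Longrightarrow> g differentiable at p \<Longrightarrow>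
    pd i (\<lambda>q. f q - g q) p = pd i f p - pd i g p"
  using pd_eqI[OF has_derivative_diff[OF has_derivative_pd has_derivative_pd]]
  by (simp add: pd_def)

lemma pd_uminus: "f differentiable at p \<Longrightarrow> pd i (\<lambda>q. - f q) p = - pd i f p"
  using pd_eqI[OF has_derivative_minus[OF has_derivative_pd]] by (simp add: pd_def)

lemma pd_mult:
  "f differentiable at p \<Longrightarrow> g differentiable at p \<Longrightarrow>
    pd i (\<lambda>q. f q * g q) p = pd i f p * g p + f p * pd i g p"
  using pd_eqI[OF has_derivative_mult[OF has_derivative_pd has_derivative_pd]]
  by (simp add: pd_def add.commute)

lemma pd_divide:
  "f differentiable at p \<Longrightarrow> g differentiable at p \<Longrightarrow> g p \<noteq> 0 \<Longrightarrow>
    pd i (\<lambda>q. f q / g q) p = (pd i f p * g p - f p * pd i g p) / (g p)\<^sup>2"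
  using pd_eqI[OF has_derivative_divide'[OF has_derivative_pd has_derivative_pd]]
  by (simp add: pd_def power2_eq_square)

lemma pd_power: "f differentiable at p \<Longrightarrow> pd i (\<lambda>q. f q ^ n) p = n * f p ^ (n - 1) * pd i f p"
  using pd_eqI[OF has_derivative_power[OF has_derivative_pd]] by (simp add: pd_def mult_ac)

lemma pd_power2: "f differentiable at p \<Longrightarrow> pd i (\<lambda>q. (f q)\<^sup>2) p = 2 * f p * pd i f p"
  by (simp add: pd_power)

lemma pd_compose:
  fixes F :: "real \<Rightarrow> real" and f :: "real^'n::finite \<Rightarrow> real"
  assumes "DERIV F (f p) :> F'" "f differentiable at p"
  shows "pd i (\<lambda>q. F (f q)) p = F' * pd i f p" "(\<lambda>q. F (f q)) differentiable at p"
proof -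
  note comp = DERIV_compose_FDERIV[OF assms(1) has_derivative_pd[OF assms(2)]]
  show "pd i (\<lambda>q. F (f q)) p = F' * pd i f p"
    using pd_eqI[OF comp] by (simp add: pd_def)
  show "(\<lambda>q. F (f q)) differentiable at p"
    using comp differentiable_def by blast
qed

lemmas pd_sqrt = pd_compose(1)[OF DERIV_real_sqrt]
  and differentiable_sqrt = pd_compose(2)[OF DERIV_real_sqrt]

lemma pd_component: "pd i (\<lambda>q. q $ j) p = (if i = j then 1 else 0)"
  by (subst pd_eqI[OF bounded_linear.has_derivative[OF bounded_linear_vec_nth has_derivative_ident]])
    (simp add: axis_def)

lemma differentiable_component: "(\<lambda>q. q $ j) differentiable at p"
  using bounded_linear_vec_nth bounded_linear_imp_differentiable by blast

lemma smooth_on_differentiable: "smooth_on S f \<Longrightarrow> p \<in> S \<Longrightarrow> f differentiable at p"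
  unfolding smooth_on_def by (metis Ck_on.simps(2))

lemma smooth_on_pd: "smooth_on S f \<Longrightarrow> smooth_on S (pd i f)"
  unfolding smooth_on_def pd_def[abs_def] by (metis Ck_on.simps(2))

lemma smooth_on_continuous: "smooth_on S f \<Longrightarrow> continuous_on S f"
  unfolding smooth_on_def by (metis Ck_on.simps(1))

lemma pd_line:
  assumes "f differentiable at (x + s *\<^sub>R axis i 1)"
  shows "((\<lambda>s. f (x + s *\<^sub>R axis i 1)) has_real_derivative pd i f (x + s *\<^sub>R axis i 1)) (at s)"
proof -
  let ?y = "x + s *\<^sub>R axis i 1"
  have "(f has_derivative frechet_derivative f (at ?y)) (at ?y)"
    using assms frechet_derivative_works by blast
  moreover have "((\<lambda>s. x + s *\<^sub>R axis i 1) has_derivative (\<lambda>s. s *\<^sub>R axis i 1)) (at s)"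
    by (auto intro!: derivative_eq_intros)
  ultimately have "((\<lambda>s. f (x + s *\<^sub>R axis i 1)) has_derivative
      (\<lambda>h. frechet_derivative f (at ?y) (h *\<^sub>R axis i 1))) (at s)"
    using diff_chain_at[of "\<lambda>s. x + s *\<^sub>R axis i 1"] by (fastforce simp: o_def)
  moreover have "(\<lambda>h. frechet_derivative f (at ?y) (h *\<^sub>R axis i 1)) = (*) (pd i f ?y)"
    using linear_scale[OF linear_frechet_derivative[OF assms]] by (auto simp: pd_def)
  ultimately show ?thesis
    by (simp add: has_field_derivative_def)
qed

text \<open>The mean value theorem is applied twice, first to the difference of \<open>f\<close> along two parallel segments in
  direction \<open>i\<close>, then to \<open>\<partial>\<^sub>i f\<close> in direction \<open>j\<close>. The left-hand side is symmetric in \<open>i\<close> and \<open>j\<close>.\<close>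

lemma second_difference:
  fixes f :: "real^'n::finite \<Rightarrow> real"
  assumes "0 < h"
    and f: "\<And>s t. 0 \<le> s \<Longrightarrow> s \<le> h \<Longrightarrow> 0 \<le> t \<Longrightarrow> t \<le> h \<Longrightarrow>
      f differentiable at (p + s *\<^sub>R axis i 1 + t *\<^sub>R axis j 1) \<and>
      pd i f differentiable at (p + s *\<^sub>R axis i 1 + t *\<^sub>R axis j 1)"
  shows "\<exists>s t. 0 < s \<and> s < h \<and> 0 < t \<and> t < h \<and>
    f (p + h *\<^sub>R axis i 1 + h *\<^sub>R axis j 1) - f (p + h *\<^sub>R axis i 1) - f (p + h *\<^sub>R axis j 1) + f p =
    h * h * pd j (pd i f) (p + s *\<^sub>R axis i 1 + t *\<^sub>R axis j 1)"
proof -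
  let ?q = "\<lambda>s t. p + s *\<^sub>R axis i 1 + t *\<^sub>R axis j (1::real)"
  have sw: "?q s t = (p + t *\<^sub>R axis j 1) + s *\<^sub>R axis i 1" for s t
    by (simp add: algebra_simps)
  have 1: "((\<lambda>s. f (?q s t)) has_real_derivative pd i f (?q s t)) (at s)"
    if "0 \<le> s" "s \<le> h" "0 \<le> t" "t \<le> h" for s t
    using pd_line[of f "p + t *\<^sub>R axis j 1" s i] f[OF that] by (simp add: sw)
  have 2: "((\<lambda>t. pd i f (?q s t)) has_real_derivative pd j (pd i f) (?q s t)) (at t)"
    if "0 \<le> s" "s \<le> h" "0 \<le> t" "t \<le> h" for s t
    using pd_line[of "pd i f" "p + s *\<^sub>R axis i 1" t j] f[OF that] by simp
  obtain s where s: "0 < s" "s < h"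
    "(f (?q h h) - f (?q h 0)) - (f (?q 0 h) - f (?q 0 0)) = (h - 0) * (pd i f (?q s h) - pd i f (?q s 0))"
    using MVT2[of 0 h "\<lambda>s. f (?q s h) - f (?q s 0)" "\<lambda>s. pd i f (?q s h) - pd i f (?q s 0)"] \<open>0 < h\<close>
      DERIV_diff[OF 1[of _ h] 1[of _ 0]] by auto
  obtain t where t: "0 < t" "t < h" "pd i f (?q s h) - pd i f (?q s 0) = (h - 0) * pd j (pd i f) (?q s t)"
    using MVT2[of 0 h "\<lambda>t. pd i f (?q s t)" "\<lambda>t. pd j (pd i f) (?q s t)"] 2 s \<open>0 < h\<close> by auto
  show ?thesis
    using s t by (intro exI[of _ s] exI[of _ t]) (simp add: algebra_simps)
qed

text \<open>If \<open>\<partial>\<^sub>j \<partial>\<^sub>i f < m < \<partial>\<^sub>i \<partial>\<^sub>j f\<close> held at \<open>p\<close>, it would hold near \<open>p\<close> by continuity. But the second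
  difference over a small square is \<open>h\<^sup>2\<close> times a value of either mixed derivative.\<close>

lemma mixed_pd_le:
  fixes f :: "real^'n::finite \<Rightarrow> real"
  assumes "open S" "p \<in> S" and f: "smooth_on S f"
  shows "pd i (pd j f) p \<le> pd j (pd i f) p"
proof (rule ccontr)
  assume "\<not> ?thesis"
  then obtain m where m: "pd j (pd i f) p < m" "m < pd i (pd j f) p"
    using dense by (metis not_le)
  define N where "N = {q \<in> S. m < pd i (pd j f) q \<and> pd j (pd i f) q < m}"
  have cont: "continuous_on S (pd k (pd l f))" for k l
    using f by (intro smooth_on_continuous smooth_on_pd)
  have "open (S \<inter> pd i (pd j f) -` {m<..})" "open (S \<inter> pd j (pd i f) -` {..<m})"
    using cont \<open>open S\<close> by (auto intro!: continuous_open_preimage)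
  moreover have "N = (S \<inter> pd i (pd j f) -` {m<..}) \<inter> (S \<inter> pd j (pd i f) -` {..<m})"
    by (auto simp: N_def)
  ultimately have "open N" by auto
  moreover have "p \<in> N"
    using m assms by (auto simp: N_def)
  ultimately obtain \<epsilon> where \<epsilon>: "\<epsilon> > 0" "ball p \<epsilon> \<subseteq> N"
    using open_contains_ball by blast
  \<comment> \<open>The far corner of a square of side \<open>h\<close> has distance at most \<open>2 h < \<epsilon>\<close> from \<open>p\<close>.\<close>
  define h where "h = \<epsilon> / 3"
  have h: "0 < h" using \<epsilon> by (simp add: h_def)
  have near: "p + s *\<^sub>R axis k 1 + t *\<^sub>R axis l 1 \<in> N"
    if "0 \<le> s" "s \<le> h" "0 \<le> t" "t \<le> h" for s t k l
  proof -
    have "norm (s *\<^sub>R axis k 1 + t *\<^sub>R axis l 1 :: real^'n) \<le> s + t"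
      using norm_triangle_ineq[of "s *\<^sub>R axis k 1 :: real^'n" "t *\<^sub>R axis l 1"] that
      by (simp add: norm_axis_1)
    also have "\<dots> < \<epsilon>" using that \<epsilon>(1) by (simp add: h_def)
    finally have "p + (s *\<^sub>R axis k 1 + t *\<^sub>R axis l 1) \<in> ball p \<epsilon>"
      by (metis add_diff_cancel_left' dist_commute dist_norm mem_ball)
    then show ?thesis using \<epsilon>(2) by (auto simp: add.assoc)
  qed
  have S: "q \<in> N \<Longrightarrow> f differentiable at q \<and> pd k f differentiable at q" for q k
    using smooth_on_differentiable[OF f] smooth_on_differentiable[OF smooth_on_pd[OF f]] by (auto simp: N_def)
  let ?d = "f (p + h *\<^sub>R axis i 1 + h *\<^sub>R axis j 1) - f (p + h *\<^sub>R axis i 1) - f (p + h *\<^sub>R axis j 1) + f p"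
  obtain s t where 1: "0 < s" "s < h" "0 < t" "t < h"
    "?d = h * h * pd j (pd i f) (p + s *\<^sub>R axis i 1 + t *\<^sub>R axis j 1)"
    using second_difference[OF h, of f p i j] S near by blast
  obtain s' t' where 2: "0 < s'" "s' < h" "0 < t'" "t' < h"
    "?d = h * h * pd i (pd j f) (p + s' *\<^sub>R axis j 1 + t' *\<^sub>R axis i 1)"
    using second_difference[OF h, of f p j i] S near by (auto simp: algebra_simps)
  have "pd j (pd i f) (p + s *\<^sub>R axis i 1 + t *\<^sub>R axis j 1) < m"
    using near[of s t i j] 1 by (auto simp: N_def)
  moreover have "m < pd i (pd j f) (p + s' *\<^sub>R axis j 1 + t' *\<^sub>R axis i 1)"
    using near[of s' t' j i] 2 by (auto simp: N_def)
  ultimately show False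
    using 1(5) 2(5) h by simp
qed

lemma mixed_pd_commute:
  fixes f :: "real^'n::finite \<Rightarrow> real"
  assumes "open S" "p \<in> S" "smooth_on S f"
  shows "pd i (pd j f) p = pd j (pd i f) p"
  using mixed_pd_le[OF assms] by (meson antisym)


section \<open>Matrices of small size\<close>

lemma vector_4 [simp]:
  "(vector [w, x, y, z] :: 'a::zero^4) $ 1 = w"
  "(vector [w, x, y, z] :: 'a::zero^4) $ 2 = x"
  "(vector [w, x, y, z] :: 'a::zero^4) $ 3 = y"
  "(vector [w, x, y, z] :: 'a::zero^4) $ 4 = z"
  by (simp_all add: vector_def)

lemma det_4:
  "det (A :: 'a::comm_ring_1^4^4) =
    A$1$1 * (A$2$2 * (A$3$3 * A$4$4 - A$3$4 * A$4$3) - A$2$3 * (A$3$2 * A$4$4 - A$3$4 * A$4$2)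
      + A$2$4 * (A$3$2 * A$4$3 - A$3$3 * A$4$2))
  - A$1$2 * (A$2$1 * (A$3$3 * A$4$4 - A$3$4 * A$4$3) - A$2$3 * (A$3$1 * A$4$4 - A$3$4 * A$4$1)
      + A$2$4 * (A$3$1 * A$4$3 - A$3$3 * A$4$1))
  + A$1$3 * (A$2$1 * (A$3$2 * A$4$4 - A$3$4 * A$4$2) - A$2$2 * (A$3$1 * A$4$4 - A$3$4 * A$4$1)
      + A$2$4 * (A$3$1 * A$4$2 - A$3$2 * A$4$1))
  - A$1$4 * (A$2$1 * (A$3$2 * A$4$3 - A$3$3 * A$4$2) - A$2$2 * (A$3$1 * A$4$3 - A$3$3 * A$4$1)
      + A$2$3 * (A$3$1 * A$4$2 - A$3$2 * A$4$1))"
proof -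
  have f234: "finite {2::4, 3, 4}" "1 \<notin> {2::4, 3, 4}" by auto
  have f34: "finite {3::4, 4}" "2 \<notin> {3::4, 4}" by auto
  have f4: "finite {4::4}" "3 \<notin> {4::4}" by auto
  show ?thesis
    unfolding det_def UNIV_4
    unfolding sum_over_permutations_insert[OF f234]
    unfolding sum_over_permutations_insert[OF f34]
    unfolding sum_over_permutations_insert[OF f4]
    unfolding permutes_sing
    by (simp add: sign_swap_id permutation_swap_id sign_compose sign_id permutation_compose
        swap_id_eq) (simp add: algebra_simps)
qed

lemma matrix_inv_unique:
  fixes A B :: "real^'n^'n"
  assumes "A ** B = mat 1"
  shows "matrix_inv A = B"
proof -
  have BA: "B ** A = mat 1" using assms matrix_left_right_inverse by blast
  then have "\<exists>A'. A ** A' = mat 1 \<and> A' ** A = mat 1" using assms by blast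
  then have "A ** matrix_inv A = mat 1 \<and> matrix_inv A ** A = mat 1"
    unfolding matrix_inv_def by (rule someI_ex)
  then show ?thesis
    by (metis BA matrix_mul_assoc matrix_mul_lid matrix_mul_rid)
qed

lemma matrix_inv_2:
  fixes a b c :: real
  assumes "a * b - c\<^sup>2 \<noteq> 0"
  shows "matrix_inv (vector [vector [a, c], vector [c, b]] :: real^2^2) =
    vector [vector [b / (a * b - c\<^sup>2), - c / (a * b - c\<^sup>2)],
            vector [- c / (a * b - c\<^sup>2), a / (a * b - c\<^sup>2)]]"
  using assms
  by (intro matrix_inv_unique)
    (simp add: vec_eq_iff matrix_matrix_mult_def mat_def forall_2 sum_2 divide_simps;
      simp add: power2_eq_square algebra_simps)

lemma matrix_inv_right_inverse:
  fixes A :: "real^'n^'n"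
  assumes "det A \<noteq> 0"
  shows "A ** matrix_inv A = mat 1"
proof -
  obtain B where "A ** B = mat 1"
    using assms invertible_det_nz invertible_def by blast
  then show ?thesis
    by (simp add: matrix_inv_unique)
qed

text \<open>A single row of the inverse is found by solving one linear system, without computing the inverse.\<close>

lemma matrix_inv_row:
  fixes A :: "real^'n^'n"
  assumes "det A \<noteq> 0" "y v* A = axis i 1"
  shows "matrix_inv A $ i = y"
proof -
  have "axis i 1 v* B = B $ i" for B :: "real^'n^'n"
    by (simp add: vec_eq_iff vector_matrix_mult_def axis_def if_distrib if_distribR cong: if_cong)
  then show ?thesis
    using matrix_inv_right_inverse[OF assms(1)] assms(2)
    by (metis vector_matrix_mul_assoc vector_matrix_mul_rid)
qed

lemma linear_system_2:
  fixes a b c x y s t :: real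
  assumes "a * b - c\<^sup>2 \<noteq> 0"
  shows "a * x + c * y = s \<and> c * x + b * y = t \<longleftrightarrow>
    x = (b * s - c * t) / (a * b - c\<^sup>2) \<and> y = (a * t - c * s) / (a * b - c\<^sup>2)"
  using assms by (auto simp: divide_simps) (algebra | simp add: power2_eq_square algebra_simps)+

text \<open>By congruence to the Minkowski form, \<open>(det P)\<^sup>2 det A = - 1\<close>.\<close>

lemma lorentzian_det_neg: "lorentzian_form A \<Longrightarrow> det A < 0"
proof -
  assume "lorentzian_form A"
  then obtain P where P: "invertible P" "transpose P ** A ** P = minkowski"
    unfolding lorentzian_form_def by blast
  have "det minkowski = - 1"
    by (simp add: minkowski_def det_4)
  then have "det P * det P * det A = - 1"
    using arg_cong[OF P(2), of det] by (simp add: det_mul mult_ac)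
  then show ?thesis
    using mult_nonneg_nonneg[of "det P * det P" "det A"] by (cases "det A < 0") auto
qed


section \<open>The divergence of a one-form in two dimensions\<close>

text \<open>The vector field dual to \<open>\<alpha>\<close> is \<open>(n1, n2) / m\<close>, and the trace of the Christoffel symbols is the logarithmic
  derivative of \<open>\<surd>m\<close>. This is the formula \<open>div \<alpha> = \<partial>\<^sub>i (n\<^sup>i / \<surd>m) / \<surd>m\<close>, written without the square root.\<close>

lemma div_form_2:
  fixes h :: "real^2 \<Rightarrow> real^2^2" and \<alpha> :: "real^2 \<Rightarrow> real^2"
    and a b c \<alpha>1 \<alpha>2 :: "real^2 \<Rightarrow> real"
  assumes N: "open N" "q \<in> N"
    and h: "\<And>y. y \<in> N \<Longrightarrow> h y = vector [vector [a y, c y], vector [c y, b y]]"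
    and \<alpha>: "\<And>y. y \<in> N \<Longrightarrow> \<alpha> y = vector [\<alpha>1 y, \<alpha>2 y]"
    and nz: "\<And>y. y \<in> N \<Longrightarrow> a y * b y - (c y)\<^sup>2 \<noteq> 0"
    and diff [simp]: "a differentiable at q" "b differentiable at q" "c differentiable at q"
      "\<alpha>1 differentiable at q" "\<alpha>2 differentiable at q"
  defines "m \<equiv> \<lambda>y. a y * b y - (c y)\<^sup>2"
    and "n1 \<equiv> \<lambda>y. b y * \<alpha>1 y - c y * \<alpha>2 y"
    and "n2 \<equiv> \<lambda>y. a y * \<alpha>2 y - c y * \<alpha>1 y"
  shows "m q * div_form h \<alpha> q =
    pd 1 n1 q + pd 2 n2 q - (n1 q * pd 1 m q + n2 q * pd 2 m q) / (2 * m q)"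
proof -
  have m_nz: "m y \<noteq> 0" if "y \<in> N" for y using nz[OF that] by (simp add: m_def)
  have inv: "matrix_inv (h y) =
      vector [vector [b y / m y, - c y / m y], vector [- c y / m y, a y / m y]]" if "y \<in> N" for y
    using matrix_inv_2[OF nz[OF that]] h[OF that] by (simp add: m_def)
  define V where "V = (\<lambda>y. matrix_inv (h y) *v \<alpha> y)"
  have V: "V y $ 1 = n1 y / m y" "V y $ 2 = n2 y / m y" if "y \<in> N" for y
    using m_nz[OF that] inv[OF that] \<alpha>[OF that]
    by (simp_all add: V_def matrix_vector_mult_def sum_2 n1_def n2_def divide_simps)
  have [simp]: "m differentiable at q" "n1 differentiable at q" "n2 differentiable at q"
    by (simp_all add: m_def n1_def n2_def)
  have pdV: "pd k (\<lambda>y. V y $ 1) q = (pd k n1 q * m q - n1 q * pd k m q) / (m q)\<^sup>2"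
    "pd k (\<lambda>y. V y $ 2) q = (pd k n2 q * m q - n2 q * pd k m q) / (m q)\<^sup>2" for k
    using pd_cong[where i = k, OF N V(1)] pd_cong[where i = k, OF N V(2)] m_nz[OF N(2)]
    by (simp_all add: pd_divide)
  have pdh: "pd k (\<lambda>y. h y $ 1 $ 1) q = pd k a q" "pd k (\<lambda>y. h y $ 1 $ 2) q = pd k c q"
    "pd k (\<lambda>y. h y $ 2 $ 1) q = pd k c q" "pd k (\<lambda>y. h y $ 2 $ 2) q = pd k b q" for k
    by (rule pd_cong[OF N], simp add: h)+
  have pdm: "pd k m q = pd k a q * b q + a q * pd k b q - 2 * c q * pd k c q" for k
    unfolding m_def by (simp add: pd_diff pd_mult pd_power2)
  have trace: "christoffel h 1 1 j q + christoffel h 2 2 j q = pd j m q / (2 * m q)" for j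
  proof (cases "j = 1")
    case True
    show ?thesis using m_nz[OF N(2)]
      by (simp add: christoffel_def sum_2 inv[OF N(2)] pdh pdm True divide_simps)
        (simp add: algebra_simps)
  next
    case False
    then have "j = 2" using exhaust_2 by blast
    then show ?thesis using m_nz[OF N(2)]
      by (simp add: christoffel_def sum_2 inv[OF N(2)] pdh pdm divide_simps)
        (simp add: algebra_simps)
  qed
  have div: "div_form h \<alpha> q = pd 1 (\<lambda>y. V y $ 1) q + pd 2 (\<lambda>y. V y $ 2) q
      + (christoffel h 1 1 1 q + christoffel h 2 2 1 q) * V q $ 1
      + (christoffel h 1 1 2 q + christoffel h 2 2 2 q) * V q $ 2"
    unfolding div_form_def V_def[symmetric] div_vec_def
    by (simp add: cov_deriv_def sum_2 axis_def) (simp add: algebra_simps)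
  show ?thesis
    using m_nz[OF N(2)] unfolding div trace pdV V[OF N(2)]
    by (simp add: divide_simps) (simp add: algebra_simps power2_eq_square)
qed


section \<open>Restriction to a coordinate sphere\<close>

lemma sphere_push_axis:
  "sphere_push (axis 1 1) = axis 3 1" "sphere_push (axis 2 1) = axis 4 1"
  by (simp_all add: sphere_push_def vec_eq_iff forall_4 axis_def)

lemma linear_sphere_push: "linear sphere_push"
  by (rule linearI) (simp_all add: sphere_push_def vec_eq_iff forall_4)

lemma has_derivative_sphere_pt: "(sphere_pt t r has_derivative sphere_push) (at q)"
proof -
  have eq: "sphere_pt t r = (\<lambda>q. vector [t, r, 0, 0] + sphere_push q)"
    by (auto simp: sphere_pt_def sphere_push_def vec_eq_iff forall_4)
  have "(sphere_push has_derivative sphere_push) (at q)"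
    using linear_sphere_push linear_conv_bounded_linear bounded_linear_imp_has_derivative by blast
  then show ?thesis
    unfolding eq using has_derivative_add[OF has_derivative_const[of "vector [t, r, 0, 0]"]] by force
qed

lemma has_derivative_on_sphere:
  assumes "f differentiable at (sphere_pt t r q)"
  shows "((\<lambda>q. f (sphere_pt t r q)) has_derivative
    (\<lambda>X. frechet_derivative f (at (sphere_pt t r q)) (sphere_push X))) (at q)"
  using diff_chain_at[OF has_derivative_sphere_pt assms[unfolded frechet_derivative_works]]
  by (simp add: o_def)

lemma differentiable_on_sphere:
  "f differentiable at (sphere_pt t r q) \<Longrightarrow> (\<lambda>q. f (sphere_pt t r q)) differentiable at q"
  using has_derivative_on_sphere differentiable_def by blast

lemma pd_on_sphere:
  assumes "f differentiable at (sphere_pt t r q)"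
  shows "pd 1 (\<lambda>q. f (sphere_pt t r q)) q = Dth f (sphere_pt t r q)"
    "pd 2 (\<lambda>q. f (sphere_pt t r q)) q = Dph f (sphere_pt t r q)"
  using pd_eqI[OF has_derivative_on_sphere[OF assms]]
  by (simp_all add: sphere_push_axis pd_def)

lemma continuous_sphere_pt: "continuous_on N (sphere_pt t r)"
  by (intro continuous_at_imp_continuous_on ballI has_derivative_continuous[OF has_derivative_sphere_pt])

lemma open_coord_sphere: "open D \<Longrightarrow> open (coord_sphere D t r)"
  using open_vimage[OF _ continuous_sphere_pt, of D t r] by (simp add: coord_sphere_def vimage_def)

lemma sphere_pt_exists: "\<exists>q. p = sphere_pt (p $ 1) (p $ 2) q"
  by (intro exI[of _ "vector [p $ 3, p $ 4]"]) (simp add: sphere_pt_def vec_eq_iff forall_4)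

lemma ip_4:
  fixes X Y :: "real^4"
  shows "ip A X Y = (\<Sum>i\<in>UNIV. \<Sum>j\<in>UNIV. X $ i * A $ i $ j * Y $ j)"
  by (simp add: ip_def inner_vec_def matrix_vector_mult_def sum_distrib_left mult.assoc)

lemma det_gbar: "det (gbar a b c d e f u v p) =
   - ((v p)\<^sup>2 * (u p)\<^sup>2 * (a p * b p - (c p)\<^sup>2)) - (d p)\<^sup>2 * (a p * b p - (c p)\<^sup>2)
   - (u p)\<^sup>2 * (b p * (e p)\<^sup>2 - 2 * c p * e p * f p + a p * (f p)\<^sup>2)"
  by (simp add: det_4 gbar_def) (simp add: power2_eq_square algebra_simps)

lemma induced_gbar:
  assumes "g (sphere_pt t r q) = gbar a b c d e f u v (sphere_pt t r q)"
  shows "induced_metric g t r q =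
    vector [vector [a (sphere_pt t r q), c (sphere_pt t r q)],
            vector [c (sphere_pt t r q), b (sphere_pt t r q)]]"
  by (simp add: induced_metric_def vec_eq_iff forall_2 sphere_push_def ip_4 sum_4 assms gbar_def axis_def)


section \<open>The connection form of the radial direction\<close>

text \<open>One chart with image \<open>D\<close> and time orientation \<open>\<tau>\<close>. That the spheres are spacelike enters through
  \<open>a > 0\<close> and \<open>a b - c\<^sup>2 > 0\<close>, the signature through the sign of the determinant.\<close>

locale straight_out_chart =
  fixes D :: "(real^4) set" and g :: "real^4 \<Rightarrow> real^4^4" and \<tau> :: "real^4 \<Rightarrow> real^4"
    and a b c d e f u v :: "real^4 \<Rightarrow> real"
  assumes open_D: "open D"
    and smooth: "smooth_on D a" "smooth_on D b" "smooth_on D c" "smooth_on D d"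
      "smooth_on D e" "smooth_on D f" "smooth_on D u" "smooth_on D v"
    and metric: "p \<in> D \<Longrightarrow> g p = gbar a b c d e f u v p"
    and area: "p \<in> D \<Longrightarrow> a p * b p - (c p)\<^sup>2 = (p $ 2) ^ 4 * (sin (p $ 3))\<^sup>2"
    and sin_nz: "p \<in> D \<Longrightarrow> sin (p $ 3) \<noteq> 0"
    and u_pos: "p \<in> D \<Longrightarrow> u p > 0"
    and a_pos: "p \<in> D \<Longrightarrow> a p > 0"
    and area_pos: "p \<in> D \<Longrightarrow> a p * b p - (c p)\<^sup>2 > 0"
    and det_neg: "p \<in> D \<Longrightarrow> det (gbar a b c d e f u v p) < 0"
    and \<tau>_continuous: "continuous_on D \<tau>"
    and \<tau>_timelike: "p \<in> D \<Longrightarrow> ip (g p) (\<tau> p) (\<tau> p) < 0"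
begin

definition m where "m p = a p * b p - (c p)\<^sup>2"
definition detg where "detg p = det (gbar a b c d e f u v p)"
definition k where "k p = c p * f p - b p * e p"
definition l where "l p = c p * e p - a p * f p"

lemma pos: assumes "p \<in> D" shows "u p > 0" "u p \<noteq> 0" "a p > 0" "m p > 0" "m p \<noteq> 0" "detg p < 0" "detg p \<noteq> 0"
  using assms u_pos[of p] a_pos[of p] area_pos[of p] det_neg[of p] unfolding m_def detg_def by simp_all

lemma gbar_mult:
  "gbar a b c d e f u v p *v w = vector
     [- (v p)\<^sup>2 * w $ 1 + d p * w $ 2 + e p * w $ 3 + f p * w $ 4,
      d p * w $ 1 + (u p)\<^sup>2 * w $ 2,
      e p * w $ 1 + a p * w $ 3 + c p * w $ 4,
      f p * w $ 1 + c p * w $ 3 + b p * w $ 4]"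
  by (simp add: vec_eq_iff forall_4 matrix_vector_mult_def sum_4 gbar_def)

lemma gbar_symmetric: "transpose (gbar a b c d e f u v p) = gbar a b c d e f u v p"
  by (simp add: transpose_def vec_eq_iff forall_4 gbar_def)

lemma vector_gbar: "w v* gbar a b c d e f u v p = gbar a b c d e f u v p *v w"
  by (metis gbar_symmetric vector_transpose_matrix)

lemma ip_gbar_symmetric: "ip (gbar a b c d e f u v p) X Y = (gbar a b c d e f u v p *v X) \<bullet> Y"
  unfolding ip_def by (metis dot_lmul_matrix vector_gbar)

lemma ip_gbar_commute: "ip (gbar a b c d e f u v p) X Y = ip (gbar a b c d e f u v p) Y X"
  by (metis inner_commute ip_def ip_gbar_symmetric)

text \<open>A vector whose dual one-form is a multiple of \<open>dt\<close>, as \<open>gbar_time_gradient\<close> shows: the gradient of \<open>t\<close>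
  rescaled to have time component 1.\<close>

definition time_gradient :: "real^4 \<Rightarrow> real^4" where
  "time_gradient p = vector [1, - d p / (u p)\<^sup>2, k p / m p, l p / m p]"

lemma gbar_time_gradient:
  assumes "p \<in> D"
  shows "gbar a b c d e f u v p *v time_gradient p = axis 1 (detg p / ((u p)\<^sup>2 * m p))"
proof -
  have "detg p = - ((v p)\<^sup>2 * (u p)\<^sup>2 * m p) - (d p)\<^sup>2 * m p + (u p)\<^sup>2 * (e p * k p + f p * l p)"
    unfolding detg_def det_gbar m_def k_def l_def by (simp add: power2_eq_square algebra_simps)
  moreover have "e p * m p + a p * k p + c p * l p = 0" "f p * m p + c p * k p + b p * l p = 0"
    unfolding m_def k_def l_def by (simp_all add: power2_eq_square algebra_simps)
  ultimately show ?thesis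
    using pos[OF assms]
    by (simp add: gbar_mult time_gradient_def vec_eq_iff forall_4 axis_def divide_simps)
      (simp add: power2_eq_square algebra_simps)
qed

lemma inverse_metric_time_row:
  assumes "p \<in> D"
  shows "matrix_inv (g p) $ 1 = ((u p)\<^sup>2 * m p / detg p) *\<^sub>R time_gradient p"
  unfolding metric[OF assms]
  using pos[OF assms] gbar_time_gradient[OF assms]
  by (intro matrix_inv_row)
    (simp_all add: detg_def[symmetric] vector_gbar matrix_vector_mult_scaleR vec_eq_iff forall_4 axis_def)

lemma sphere_normal_iff:
  assumes "p \<in> D"
  shows "sphere_normal (g p) w \<longleftrightarrow> (g p *v w) $ 3 = 0 \<and> (g p *v w) $ 4 = 0"
proof -
  have "ip (g p) w (sphere_push X) = (g p *v w) $ 3 * X $ 1 + (g p *v w) $ 4 * X $ 2" for X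
    by (simp add: metric[OF assms] ip_gbar_symmetric inner_vec_def sum_4 sphere_push_def)
  then have "sphere_normal (g p) w \<longleftrightarrow>
      (\<forall>X::real^2. (g p *v w) $ 3 * X $ 1 + (g p *v w) $ 4 * X $ 2 = 0)"
    by (auto simp: sphere_normal_def sphere_tangent_def)
  also have "\<dots> \<longleftrightarrow> (g p *v w) $ 3 = 0 \<and> (g p *v w) $ 4 = 0"
  proof safe
    assume *: "\<forall>X::real^2. (g p *v w) $ 3 * X $ 1 + (g p *v w) $ 4 * X $ 2 = 0"
    show "(g p *v w) $ 3 = 0" using *[rule_format, of "axis 1 1"] by (simp add: axis_def)
    show "(g p *v w) $ 4 = 0" using *[rule_format, of "axis 2 1"] by (simp add: axis_def)
  qed auto
  finally show ?thesis .
qed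

text \<open>The projection is defined by a unique existence property, which amounts to solving the \<open>2 \<times> 2\<close> system of \<open>g\<^sub>S\<close>
  for the tangential part. Pairing with a normal vector then does not see that part.\<close>

lemma ip_normal_proj:
  assumes p: "p \<in> D" and w: "sphere_normal (g p) w"
  shows "ip (g p) (normal_proj (g p) Y) w = ip (g p) Y w"
proof -
  let ?m = "a p * b p - (c p)\<^sup>2"
  let ?s = "(g p *v Y) $ 3" and ?t = "(g p *v Y) $ 4"
  define X :: "real^2" where "X = vector [(b p * ?s - c p * ?t) / ?m, (a p * ?t - c p * ?s) / ?m]"
  have "sphere_normal (g p) (Y - sphere_push Z) \<longleftrightarrow> Z = X" for Z
    unfolding sphere_normal_iff[OF p] X_def vec_eq_iff forall_2
    using linear_system_2[of "a p" "b p" "c p" "Z $ 1" "Z $ 2" ?s ?t] area_pos[OF p]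
    by (auto simp: matrix_vector_mult_diff_distrib metric[OF p] gbar_mult sphere_push_def)
  then have "normal_proj (g p) Y = Y - sphere_push X"
    unfolding normal_proj_def sphere_tangent_def
    by (intro the_equality) (auto simp: image_iff, metis add_diff_cancel_left' diff_add_cancel)
  moreover have "ip (g p) (sphere_push X) w = 0"
    using w ip_gbar_commute[of p w] by (simp add: sphere_normal_def sphere_tangent_def metric[OF p])
  ultimately show ?thesis
    by (simp add: ip_def inner_diff_left)
qed

text \<open>A vector without \<open>\<partial>\<^sub>t\<close> component is tangent to a slice of constant \<open>t\<close>, where the metric is
  \<open>u\<^sup>2 dr\<^sup>2 + g\<^sub>S\<close> and thus positive definite; completing the square shows it.\<close>

lemma time_component_nonzero:
  assumes p: "p \<in> D"
  shows "\<tau> p $ 1 \<noteq> 0"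
proof
  assume "\<tau> p $ 1 = 0"
  then have "a p * ip (g p) (\<tau> p) (\<tau> p) =
      a p * (u p * \<tau> p $ 2)\<^sup>2 + (a p * \<tau> p $ 3 + c p * \<tau> p $ 4)\<^sup>2 + m p * (\<tau> p $ 4)\<^sup>2"
    unfolding metric[OF p] ip_def gbar_mult
    by (simp add: inner_vec_def sum_4 m_def power2_eq_square algebra_simps)
  moreover have "\<dots> \<ge> 0"
    using pos[OF p] by simp
  ultimately show False
    using mult_pos_neg[OF pos(3)[OF p] \<tau>_timelike[OF p]] by simp
qed

definition \<rho> where "\<rho> p = sqrt (m p / - detg p)"

text \<open>The normal vectors orthogonal to \<open>e_r\<close> form the line spanned by the gradient of \<open>t\<close>. The unit length
  determines the factor up to sign, and future orientation selects the sign of the time component of \<open>\<tau>\<close>.\<close>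

lemma normal_perp_e_r:
  assumes p: "p \<in> D"
  shows "normal_perp g \<tau> (e_r u) p = (sgn (\<tau> p $ 1) * u p * \<rho> p) *\<^sub>R time_gradient p"
proof -
  define \<kappa> where "\<kappa> = detg p / ((u p)\<^sup>2 * m p)"
  have \<kappa>: "\<kappa> < 0"
    using pos[OF p] by (simp add: \<kappa>_def divide_neg_pos)
  have dual: "g p *v (s *\<^sub>R time_gradient p) = axis 1 (s * \<kappa>)" for s
    using gbar_time_gradient[OF p] by (simp add: \<kappa>_def metric[OF p] matrix_vector_mult_scaleR vec_eq_iff axis_def)
  have ipw: "ip (g p) (s *\<^sub>R time_gradient p) Y = s * \<kappa> * Y $ 1" for s Y
    using dual[of s] unfolding metric[OF p] ip_gbar_symmetric by (simp add: inner_axis')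
  have ray: "sphere_normal (g p) w \<and> ip (g p) w (e_r u p) = 0 \<longleftrightarrow> w = (w $ 1) *\<^sub>R time_gradient p" for w
  proof
    assume w: "sphere_normal (g p) w \<and> ip (g p) w (e_r u p) = 0"
    then have "e p * w $ 1 + a p * w $ 3 + c p * w $ 4 = 0" "f p * w $ 1 + c p * w $ 3 + b p * w $ 4 = 0"
      unfolding sphere_normal_iff[OF p] by (simp_all add: metric[OF p] gbar_mult)
    then have "a p * w $ 3 + c p * w $ 4 = - e p * w $ 1" "c p * w $ 3 + b p * w $ 4 = - f p * w $ 1"
      by linarith+
    then have "w $ 3 = (b p * (- e p * w $ 1) - c p * (- f p * w $ 1)) / m p \<and>
        w $ 4 = (a p * (- f p * w $ 1) - c p * (- e p * w $ 1)) / m p"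
      using linear_system_2[of "a p" "b p" "c p"] pos(5)[OF p] unfolding m_def by blast
    moreover have "d p * w $ 1 + (u p)\<^sup>2 * w $ 2 = 0"
      using w pos[OF p] by (simp add: metric[OF p] ip_gbar_symmetric gbar_mult e_r_def inner_axis)
    then have "w $ 2 = - d p * w $ 1 / (u p)\<^sup>2"
      using pos[OF p] by (simp add: divide_simps) (simp add: algebra_simps)
    ultimately show "w = (w $ 1) *\<^sub>R time_gradient p"
      by (simp add: vec_eq_iff forall_4 time_gradient_def k_def l_def algebra_simps)
  next
    assume "w = (w $ 1) *\<^sub>R time_gradient p"
    then obtain s where w: "w = s *\<^sub>R time_gradient p" by blast
    show "sphere_normal (g p) w \<and> ip (g p) w (e_r u p) = 0"
      unfolding sphere_normal_iff[OF p] w dual ipw by (simp add: axis_def e_r_def)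
  qed
  have \<rho>: "(u p * \<rho> p)\<^sup>2 * \<kappa> = - 1" "u p * \<rho> p > 0"
    using pos[OF p] by (auto simp: \<kappa>_def \<rho>_def power_mult_distrib divide_simps)
  have scale: "s * \<kappa> * s = - 1 \<and> s * \<kappa> * \<tau> p $ 1 < 0 \<longleftrightarrow> s = sgn (\<tau> p $ 1) * u p * \<rho> p" for s
  proof
    assume s: "s * \<kappa> * s = - 1 \<and> s * \<kappa> * \<tau> p $ 1 < 0"
    then have "s\<^sup>2 * \<kappa> = (u p * \<rho> p)\<^sup>2 * \<kappa>"
      using \<rho> by (simp add: power2_eq_square mult_ac)
    then have "s\<^sup>2 = (u p * \<rho> p)\<^sup>2" using \<kappa> by auto
    then have "\<bar>s\<bar> = u p * \<rho> p"
      using \<rho>(2) by (metis abs_of_pos power2_eq_iff_nonneg abs_ge_zero power2_abs less_imp_le)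
    moreover have "(s * \<tau> p $ 1) * \<kappa> < 0" using s by (simp add: mult_ac)
    then have "s * \<tau> p $ 1 > 0" using \<kappa> by (metis mult_nonpos_nonpos less_imp_le not_le)
    then have "sgn (\<tau> p $ 1) = sgn s"
      by (auto simp: zero_less_mult_iff)
    ultimately show "s = sgn (\<tau> p $ 1) * u p * \<rho> p"
      by (metis mult.assoc mult.commute mult_sgn_abs)
  next
    assume s: "s = sgn (\<tau> p $ 1) * u p * \<rho> p"
    have "s * \<kappa> * s = (sgn (\<tau> p $ 1))\<^sup>2 * ((u p * \<rho> p)\<^sup>2 * \<kappa>)"
      unfolding s by (simp add: power2_eq_square mult_ac)
    then have "s * \<kappa> * s = - 1"
      using \<rho>(1) time_component_nonzero[OF p] by (simp add: sgn_if)
    moreover have "s * \<kappa> * \<tau> p $ 1 = \<kappa> * (u p * \<rho> p) * \<bar>\<tau> p $ 1\<bar>"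
      unfolding s abs_sgn by (simp add: mult_ac)
    moreover have "\<kappa> * (u p * \<rho> p) * \<bar>\<tau> p $ 1\<bar> < 0"
      using \<kappa> \<rho>(2) time_component_nonzero[OF p] by (simp add: mult_neg_pos)
    ultimately show "s * \<kappa> * s = - 1 \<and> s * \<kappa> * \<tau> p $ 1 < 0" by metis
  qed
  have "sphere_normal (g p) w \<and> ip (g p) w w = - 1 \<and> ip (g p) w (e_r u p) = 0 \<and>
      future_timelike (g p) (\<tau> p) w \<longleftrightarrow> w = (sgn (\<tau> p $ 1) * u p * \<rho> p) *\<^sub>R time_gradient p"
    (is "?P \<longleftrightarrow> ?Q") for w
  proof -
    have "?P \<longleftrightarrow> w = (w $ 1) *\<^sub>R time_gradient p \<and> ip (g p) w w = - 1 \<and> ip (g p) w (\<tau> p) < 0"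
      using ray[of w] by (auto simp: future_timelike_def)
    also have "\<dots> \<longleftrightarrow> (\<exists>s. w = s *\<^sub>R time_gradient p \<and> s * \<kappa> * s = - 1 \<and> s * \<kappa> * \<tau> p $ 1 < 0)"
    proof -
      have "(s *\<^sub>R time_gradient p) $ 1 = s" for s by (simp add: time_gradient_def)
      then show ?thesis by (metis ipw)
    qed
    also have "\<dots> \<longleftrightarrow> ?Q" unfolding scale by blast
    finally show ?thesis .
  qed
  then show ?thesis unfolding normal_perp_def by simp
qed

text \<open>The components of the connection form of \<open>e_r\<close> up to the common factor \<open>\<plusminus> \<rho> / 2\<close>.\<close>

definition \<beta>3 where "\<beta>3 p = Dr e p + Dth d p - 2 * d p / u p * Dth u p
    + k p / m p * Dr a p + l p / m p * Dr c p"
definition \<beta>4 where "\<beta>4 p = Dr f p + Dph d p - 2 * d p / u p * Dph u p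
    + k p / m p * Dr c p + l p / m p * Dr b p"

lemma pd_metric: "p \<in> D \<Longrightarrow> pd i (\<lambda>q. g q $ j $ j') p = pd i (\<lambda>q. gbar a b c d e f u v q $ j $ j') p"
  by (rule pd_cong[OF open_D]) (auto simp: metric)

lemma smooth_diff: assumes "p \<in> D" shows
  "a differentiable at p" "b differentiable at p" "c differentiable at p" "d differentiable at p"
  "e differentiable at p" "f differentiable at p" "u differentiable at p" "v differentiable at p"
  using smooth smooth_on_differentiable assms by blast+

lemma christoffel_e_r:
  assumes p: "p \<in> D"
  shows "christoffel g 1 3 2 p = (u p)\<^sup>2 * m p / (2 * detg p) * \<beta>3 p"
    "christoffel g 1 4 2 p = (u p)\<^sup>2 * m p / (2 * detg p) * \<beta>4 p"
  unfolding christoffel_def pd_metric[OF p] inverse_metric_time_row[OF p] sum_4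
  using pos[OF p] smooth_diff[OF p]
  by (simp_all add: gbar_def time_gradient_def pd_const pd_power2 \<beta>3_def \<beta>4_def divide_simps)
    (simp_all add: power2_eq_square algebra_simps)

text \<open>As the dual one-form of \<open>e_r\<^sup>\<bottom>\<close> is a multiple of \<open>dt\<close>, only the time component of the covariant derivative of
  \<open>e_r = \<partial>\<^sub>r / u\<close> contributes. The derivative of \<open>1 / u\<close> points in direction \<open>\<partial>\<^sub>r\<close> and drops out.\<close>

lemma connection_form_e_r:
  assumes p: "p \<in> D"
  shows "connection_form g \<tau> (e_r u) p (axis 3 1) = sgn (\<tau> p $ 1) / 2 * \<rho> p * \<beta>3 p"
    "connection_form g \<tau> (e_r u) p (axis 4 1) = sgn (\<tau> p $ 1) / 2 * \<rho> p * \<beta>4 p"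
proof -
  let ?w = "normal_perp g \<tau> (e_r u) p"
  have w: "g p *v ?w = axis 1 (sgn (\<tau> p $ 1) * u p * \<rho> p * (detg p / ((u p)\<^sup>2 * m p)))"
    using gbar_time_gradient[OF p]
    by (simp add: metric[OF p] normal_perp_e_r[OF p] matrix_vector_mult_scaleR vec_eq_iff axis_def)
  then have "sphere_normal (g p) ?w"
    unfolding sphere_normal_iff[OF p] by (simp add: axis_def)
  then have *: "connection_form g \<tau> (e_r u) p X = cov_deriv g X (e_r u) p \<bullet> (g p *v ?w)" for X
    by (simp add: connection_form_def normal_connection_def ip_normal_proj[OF p]) (simp add: ip_def)
  show "connection_form g \<tau> (e_r u) p (axis 3 1) = sgn (\<tau> p $ 1) / 2 * \<rho> p * \<beta>3 p"
    "connection_form g \<tau> (e_r u) p (axis 4 1) = sgn (\<tau> p $ 1) / 2 * \<rho> p * \<beta>4 p"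
    using pos[OF p] unfolding * w inner_axis
    by (simp_all add: cov_deriv_def sum_4 e_r_def axis_def pd_const christoffel_e_r[OF p] divide_simps power2_eq_square)
qed


section \<open>The divergence of the connection form\<close>

lemma smooth_diff_pd: assumes "p \<in> D" shows
  "pd i a differentiable at p" "pd i b differentiable at p" "pd i c differentiable at p"
  "pd i d differentiable at p" "pd i e differentiable at p" "pd i f differentiable at p"
  "pd i u differentiable at p"
  using smooth smooth_on_pd smooth_on_differentiable assms by blast+

lemma coefficients_differentiable:
  assumes p: "p \<in> D"
  shows "m differentiable at p" "k differentiable at p" "l differentiable at p"
    "detg differentiable at p"
  unfolding m_def[abs_def] k_def[abs_def] l_def[abs_def] detg_def[abs_def] det_gbar
  by (simp_all add: smooth_diff[OF p])

text \<open>Since \<open>m = r\<^sup>4 sin\<^sup>2 \<theta>\<close>, the area element of the spheres is that of the round spheres of radius \<open>r\<close>.\<close>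

lemma pd_m:
  assumes p: "p \<in> D"
  shows "Dth m p = 2 * cot (p $ 3) * m p" "Dph m p = 0"
proof -
  have eq: "m q = (q $ 2) ^ 4 * (sin (q $ 3))\<^sup>2" if "q \<in> D" for q
    using area[OF that] by (simp add: m_def)
  have s: "pd i (\<lambda>q. sin (q $ 3)) p = cos (p $ 3) * (if i = 3 then 1 else 0)"
    "(\<lambda>q. sin (q $ 3)) differentiable at p" for i
    by (rule pd_compose(1)[OF DERIV_sin differentiable_component, THEN trans], simp add: pd_component)
      (rule pd_compose(2)[OF DERIV_sin differentiable_component])
  have "pd i m p = pd i (\<lambda>q. (q $ 2) ^ 4 * (sin (q $ 3))\<^sup>2) p" for i
    by (rule pd_cong[OF open_D p eq])
  then have "pd i m p = 4 * (p $ 2) ^ 3 * (if i = 2 then 1 else 0) * (sin (p $ 3))\<^sup>2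
      + (p $ 2) ^ 4 * (2 * sin (p $ 3) * (cos (p $ 3) * (if i = 3 then 1 else 0)))" for i
    by (simp add: pd_mult pd_power pd_component s differentiable_component)
  then show "Dth m p = 2 * cot (p $ 3) * m p" "Dph m p = 0"
    using sin_nz[OF p] by (simp_all add: eq[OF p] cot_def power2_eq_square)
qed

lemma pd_\<rho>:
  assumes p: "p \<in> D"
  shows "Dth \<rho> p = \<rho> p * (cot (p $ 3) - hld 3 (gbar a b c d e f u v) p)"
    "Dph \<rho> p = - \<rho> p * hld 4 (gbar a b c d e f u v) p"
    "\<rho> differentiable at p"
proof -
  let ?x = "m p / - detg p"
  have x: "?x > 0" using pos[OF p] by (simp add: divide_pos_neg)
  have diff: "(\<lambda>q. m q / - detg q) differentiable at p"
    using coefficients_differentiable[OF p] pos[OF p] by simp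
  show "\<rho> differentiable at p"
    unfolding \<rho>_def[abs_def] using differentiable_sqrt[OF x diff] .
  have hld: "hld i (gbar a b c d e f u v) p = pd i detg p / (2 * detg p)" for i
    by (simp add: hld_def detg_def[abs_def])
  have sqrt_deriv: "inverse (sqrt y) / 2 * (y * (s - 2 * t)) = sqrt y * (s / 2 - t)"
    if "y > 0" for s t y :: real
  proof -
    have "inverse z / 2 * (y * (s - 2 * t)) = y / z * (s / 2 - t)" for z
      by (cases "z = 0") (simp_all add: field_simps)
    then show ?thesis using that by (simp only: real_div_sqrt less_imp_le)
  qed
  have quotient: "pd i (\<lambda>q. m q / - detg q) p = ?x * (pd i m p / m p - 2 * hld i (gbar a b c d e f u v) p)" for i
    using coefficients_differentiable[OF p] pos[OF p]
    by (simp add: pd_divide pd_uminus hld divide_simps) (simp add: power2_eq_square algebra_simps)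
  have "pd i \<rho> p = \<rho> p * (pd i m p / m p / 2 - hld i (gbar a b c d e f u v) p)" for i
    unfolding \<rho>_def[abs_def] pd_sqrt[OF x diff] quotient by (rule sqrt_deriv[OF x])
  then show "Dth \<rho> p = \<rho> p * (cot (p $ 3) - hld 3 (gbar a b c d e f u v) p)"
    "Dph \<rho> p = - \<rho> p * hld 4 (gbar a b c d e f u v) p"
    using pos[OF p] by (simp_all add: pd_m[OF p])
qed

text \<open>The components of the vector field dual to the one-form \<open>(\<omega>3, \<omega>4)\<close> on the sphere, multiplied by \<open>m\<close>.\<close>

definition flux3 where "flux3 \<omega>3 \<omega>4 p = b p * \<omega>3 p - c p * \<omega>4 p"
definition flux4 where "flux4 \<omega>3 \<omega>4 p = a p * \<omega>4 p - c p * \<omega>3 p"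

lemma induced_metric_eq:
  "q \<in> coord_sphere D t r \<Longrightarrow> induced_metric g t r q =
    vector [vector [a (sphere_pt t r q), c (sphere_pt t r q)],
            vector [c (sphere_pt t r q), b (sphere_pt t r q)]]"
  by (rule induced_gbar) (simp add: coord_sphere_def metric)

lemma div_form_on_sphere:
  assumes N: "open N" "q \<in> N" "N \<subseteq> coord_sphere D t r"
    and \<alpha>: "\<And>y. y \<in> N \<Longrightarrow> \<alpha> y = vector [\<omega>3 (sphere_pt t r y), \<omega>4 (sphere_pt t r y)]"
  defines "p \<equiv> sphere_pt t r q"
  assumes \<omega>: "\<omega>3 differentiable at p" "\<omega>4 differentiable at p"
  shows "m p * div_form (induced_metric g t r) \<alpha> q =
    Dth (flux3 \<omega>3 \<omega>4) p + Dph (flux4 \<omega>3 \<omega>4) p - cot (p $ 3) * flux3 \<omega>3 \<omega>4 p"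
proof -
  have D: "sphere_pt t r y \<in> D" if "y \<in> N" for y
    using that N by (auto simp: coord_sphere_def)
  then have p: "p \<in> D" using N by (simp add: p_def)
  note diff = smooth_diff[OF p]
  have flux: "flux3 \<omega>3 \<omega>4 differentiable at p" "flux4 \<omega>3 \<omega>4 differentiable at p"
    unfolding flux3_def[abs_def] flux4_def[abs_def] by (simp_all add: diff \<omega>)
  have nz: "a (sphere_pt t r y) * b (sphere_pt t r y) - (c (sphere_pt t r y))\<^sup>2 \<noteq> 0" if "y \<in> N" for y
    using area_pos[OF D[OF that]] by simp
  have "m p * div_form (induced_metric g t r) \<alpha> q =
      pd 1 (\<lambda>y. flux3 \<omega>3 \<omega>4 (sphere_pt t r y)) q + pd 2 (\<lambda>y. flux4 \<omega>3 \<omega>4 (sphere_pt t r y)) q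
      - (flux3 \<omega>3 \<omega>4 p * pd 1 (\<lambda>y. m (sphere_pt t r y)) q
       + flux4 \<omega>3 \<omega>4 p * pd 2 (\<lambda>y. m (sphere_pt t r y)) q) / (2 * m p)"
    unfolding flux3_def flux4_def m_def p_def
    by (rule div_form_2[OF N(1,2) _ _ nz])
      (use N D \<alpha> diff \<omega> in \<open>auto simp: p_def intro!: induced_metric_eq differentiable_on_sphere\<close>)
  then show ?thesis
    using flux coefficients_differentiable(1)[OF p] pos[OF p]
    by (simp add: p_def pd_on_sphere pd_m[OF p[unfolded p_def]])
qed

lemma laplacian_on_sphere:
  assumes q: "q \<in> coord_sphere D t r" and w: "smooth_on D w"
  defines "p \<equiv> sphere_pt t r q"
  shows "m p * laplacian (induced_metric g t r) (\<lambda>q. w (sphere_pt t r q)) q =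
    Dth (flux3 (Dth w) (Dph w)) p + Dph (flux4 (Dth w) (Dph w)) p
      - cot (p $ 3) * flux3 (Dth w) (Dph w) p"
  unfolding laplacian_def p_def
proof (rule div_form_on_sphere[OF open_coord_sphere[OF open_D] q subset_refl])
  have p: "p \<in> D" using q by (simp add: coord_sphere_def p_def)
  show "Dth w differentiable at (sphere_pt t r q)" "Dph w differentiable at (sphere_pt t r q)"
    using smooth_on_differentiable[OF smooth_on_pd[OF w] p] by (simp_all add: p_def)
  show "(\<chi> i. pd i (\<lambda>q. w (sphere_pt t r q)) y) = vector [Dth w (sphere_pt t r y), Dph w (sphere_pt t r y)]"
    if "y \<in> coord_sphere D t r" for y
    using that smooth_on_differentiable[OF w]
    by (simp add: coord_sphere_def vec_eq_iff forall_2 pd_on_sphere)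
qed

lemma pd_\<beta>:
  assumes p: "p \<in> D"
  shows "\<beta>3 differentiable at p" "\<beta>4 differentiable at p"
    "pd i \<beta>3 p = pd i (Dr e) p + pd i (Dth d) p
       - 2 * ((pd i d p - d p * pd i u p / u p) * Dth u p + d p * pd i (Dth u) p) / u p
       + ((pd i k p - k p * pd i m p / m p) * Dr a p + k p * pd i (Dr a) p
        + (pd i l p - l p * pd i m p / m p) * Dr c p + l p * pd i (Dr c) p) / m p"
    "pd i \<beta>4 p = pd i (Dr f) p + pd i (Dph d) p
       - 2 * ((pd i d p - d p * pd i u p / u p) * Dph u p + d p * pd i (Dph u) p) / u p
       + ((pd i k p - k p * pd i m p / m p) * Dr c p + k p * pd i (Dr c) p
        + (pd i l p - l p * pd i m p / m p) * Dr b p + l p * pd i (Dr b) p) / m p"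
proof -
  note diff = smooth_diff[OF p] smooth_diff_pd[OF p] coefficients_differentiable[OF p]
  note nz = pos[OF p]
  show "\<beta>3 differentiable at p" "\<beta>4 differentiable at p"
    unfolding \<beta>3_def[abs_def] \<beta>4_def[abs_def] using nz by (simp_all add: diff)
  show "pd i \<beta>3 p = pd i (Dr e) p + pd i (Dth d) p
       - 2 * ((pd i d p - d p * pd i u p / u p) * Dth u p + d p * pd i (Dth u) p) / u p
       + ((pd i k p - k p * pd i m p / m p) * Dr a p + k p * pd i (Dr a) p
        + (pd i l p - l p * pd i m p / m p) * Dr c p + l p * pd i (Dr c) p) / m p"
    unfolding \<beta>3_def[abs_def] using nz
    by (simp add: diff pd_add pd_diff pd_mult pd_divide pd_const)
      (simp add: field_simps power2_eq_square)
  show "pd i \<beta>4 p = pd i (Dr f) p + pd i (Dph d) p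
       - 2 * ((pd i d p - d p * pd i u p / u p) * Dph u p + d p * pd i (Dph u) p) / u p
       + ((pd i k p - k p * pd i m p / m p) * Dr c p + k p * pd i (Dr c) p
        + (pd i l p - l p * pd i m p / m p) * Dr b p + l p * pd i (Dr b) p) / m p"
    unfolding \<beta>4_def[abs_def] using nz
    by (simp add: diff pd_add pd_diff pd_mult pd_divide pd_const)
      (simp add: field_simps power2_eq_square)
qed

lemma pd_pd_u2:
  assumes p: "p \<in> D"
  shows "pd i (pd j (\<lambda>q. (u q)\<^sup>2)) p = 2 * (pd i u p * pd j u p + u p * pd i (pd j u) p)"
proof -
  have "pd i (pd j (\<lambda>q. (u q)\<^sup>2)) p = pd i (\<lambda>q. 2 * u q * pd j u q) p"
    by (rule pd_cong[OF open_D p]) (simp add: pd_power2 smooth_diff)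
  then show ?thesis
    by (simp add: pd_mult pd_const smooth_diff[OF p] smooth_diff_pd[OF p])
qed

lemma pd_flux:
  assumes p: "p \<in> D" and \<omega>: "\<omega>3 differentiable at p" "\<omega>4 differentiable at p"
  shows "pd i (flux3 \<omega>3 \<omega>4) p =
      pd i b p * \<omega>3 p + b p * pd i \<omega>3 p - pd i c p * \<omega>4 p - c p * pd i \<omega>4 p"
    "pd i (flux4 \<omega>3 \<omega>4) p =
      pd i a p * \<omega>4 p + a p * pd i \<omega>4 p - pd i c p * \<omega>3 p - c p * pd i \<omega>3 p"
  using \<omega> smooth_diff[OF p] unfolding flux3_def[abs_def] flux4_def[abs_def]
  by (simp_all add: pd_diff pd_mult)

text \<open>Up to the factor \<open>\<plusminus> \<rho> / 2\<close> the left-hand side is \<open>m div \<alpha>\<close>, and the right-hand side is \<open>m (\<Delta>d + G)\<close>.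
  After expansion this is a polynomial identity in the metric coefficients, their derivatives, \<open>1 / u\<close>
  and \<open>1 / m\<close>. Both mixed derivatives of \<open>u\<close> occur on the left, only one of them in \<open>F\<close>; this is where
  they have to commute.\<close>

lemma divergence_identity:
  assumes p: "p \<in> D"
  defines "L \<equiv> \<lambda>i. hld i (gbar a b c d e f u v) p"
  shows "Dth (flux3 \<beta>3 \<beta>4) p + Dph (flux4 \<beta>3 \<beta>4) p - L 3 * flux3 \<beta>3 \<beta>4 p - L 4 * flux4 \<beta>3 \<beta>4 p =
    Dth (flux3 (Dth d) (Dph d)) p + Dph (flux4 (Dth d) (Dph d)) p
      - cot (p $ 3) * flux3 (Dth d) (Dph d) p + F_term a b c d e f u v p"
proof -
  note diff = smooth_diff[OF p] smooth_diff_pd[OF p] pd_\<beta>(1,2)[OF p]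
  note nz = pos(2,5)[OF p]
  have kl: "(\<lambda>q. c q * f q - b q * e q) = k" "(\<lambda>q. c q * e q - a q * f q) = l"
    by (auto simp: k_def l_def)
  have m: "a p * b p - (c p)\<^sup>2 = m p" by (simp add: m_def)
  have kl': "c p * f p - b p * e p = k p" "c p * e p - a p * f p = l p" by (simp_all add: k_def l_def)
  have mixed: "Dth (Dph u) p = Dph (Dth u) p"
    using mixed_pd_commute[OF open_D p smooth(7)] .
  \<comment> \<open>One power of \<open>u\<close> cancels in the terms with \<open>(u\<^sup>2)\<^sub>,\<^sub>i\<^sub>j\<close>, and \<open>m\<close> cancels in its logarithmic derivative
    below. Then \<open>1 / u\<close> and \<open>1 / m\<close> can be treated as indeterminates.\<close>
  have u2: "d p / (u p)\<^sup>2 * (b p * (2 * (x * x + u p * x1)) - 2 * c p * (2 * (y * x + u p * x2))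
        + a p * (2 * (y * y + u p * x3)))
     = 2 * d p / u p * (b p * (x * x / u p + x1) - 2 * c p * (y * x / u p + x2)
        + a p * (y * y / u p + x3))" for x y x1 x2 x3
    using nz by (simp add: divide_simps) (simp add: power2_eq_square algebra_simps)
  have L: "hld i (gbar a b c d e f u v) p = L i" for i by (simp add: L_def)
  have cancel: "x * (2 * cot (p $ 3) * m p) / m p = 2 * cot (p $ 3) * x" for x
    using nz by simp
  show ?thesis
    unfolding F_term_def Let_def kl kl' m L pd_pd_u2[OF p] u2
      pd_flux[OF p diff(16,17)] pd_flux[OF p diff(12,12)] pd_\<beta>(3,4)[OF p] pd_m[OF p] cancel
    unfolding flux3_def flux4_def \<beta>3_def \<beta>4_def mixed
    by (simp add: divide_inverse algebra_simps)
qed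

definition operator where
  "operator = straight_out_operator (induced_metric g) a b c e f u v"

lemma m_operator:
  assumes q: "q \<in> coord_sphere D t r" and w: "smooth_on D w"
  defines "p \<equiv> sphere_pt t r q"
  shows "m p * operator w t r q = Dth (flux3 (Dth w) (Dph w)) p + Dph (flux4 (Dth w) (Dph w)) p
      - cot (p $ 3) * flux3 (Dth w) (Dph w) p + F_term a b c w e f u v p"
proof -
  have p: "p \<in> D" using q by (simp add: coord_sphere_def p_def)
  have "m p * G_term a b c w e f u v p = F_term a b c w e f u v p"
    using pos(5)[OF p] area[OF p] by (simp add: G_term_def m_def)
  then show ?thesis
    using laplacian_on_sphere[OF q w] unfolding operator_def straight_out_operator_def p_def
    by (simp add: distrib_left)
qed

text \<open>The sign is constant only near a given point, so the divergence formula is applied on the open set \<open>N\<close> where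
  the time component of \<open>\<tau>\<close> has the same sign as at that point.\<close>

lemma div_connection_form:
  assumes q: "q \<in> coord_sphere D t r"
  defines "p \<equiv> sphere_pt t r q"
  shows "div_form (induced_metric g t r) (sphere_connection_form g \<tau> (e_r u) t r) q =
    sgn (\<tau> p $ 1) / 2 * \<rho> p * operator d t r q"
proof -
  define s where "s = sgn (\<tau> p $ 1) / 2"
  have p: "p \<in> D" using q by (simp add: coord_sphere_def p_def)
  define N where "N = coord_sphere D t r \<inter> (\<lambda>y. s * \<tau> (sphere_pt t r y) $ 1) -` {0<..}"
  have "sphere_pt t r ` coord_sphere D t r \<subseteq> D" by (auto simp: coord_sphere_def)
  then have "continuous_on (coord_sphere D t r) (\<lambda>y. s * \<tau> (sphere_pt t r y) $ 1)"
    by (intro continuous_intros continuous_on_compose2[OF \<tau>_continuous continuous_sphere_pt])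
  then have "open N"
    unfolding N_def by (intro continuous_open_preimage open_coord_sphere open_D) auto
  moreover have "q \<in> N"
    using q time_component_nonzero[OF p] by (auto simp: N_def s_def p_def sgn_if)
  moreover have "N \<subseteq> coord_sphere D t r" by (auto simp: N_def)
  moreover have "sphere_connection_form g \<tau> (e_r u) t r y =
      vector [s * \<rho> (sphere_pt t r y) * \<beta>3 (sphere_pt t r y),
              s * \<rho> (sphere_pt t r y) * \<beta>4 (sphere_pt t r y)]" if "y \<in> N" for y
  proof -
    have y: "sphere_pt t r y \<in> D" using that by (simp add: N_def coord_sphere_def)
    have "sgn (\<tau> (sphere_pt t r y) $ 1) / 2 = s"
      using that by (auto simp: N_def s_def sgn_if split: if_splits)
    then show ?thesis
      by (simp add: sphere_connection_form_def vec_eq_iff forall_2 sphere_push_axis connection_form_e_r[OF y])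
  qed
  moreover have "(\<lambda>p. s * \<rho> p * \<beta>3 p) differentiable at p" "(\<lambda>p. s * \<rho> p * \<beta>4 p) differentiable at p"
    using pd_\<rho>(3)[OF p] pd_\<beta>(1,2)[OF p] by simp_all
  ultimately have div: "m p * div_form (induced_metric g t r) (sphere_connection_form g \<tau> (e_r u) t r) q =
    Dth (flux3 (\<lambda>p. s * \<rho> p * \<beta>3 p) (\<lambda>p. s * \<rho> p * \<beta>4 p)) p
    + Dph (flux4 (\<lambda>p. s * \<rho> p * \<beta>3 p) (\<lambda>p. s * \<rho> p * \<beta>4 p)) p
    - cot (p $ 3) * flux3 (\<lambda>p. s * \<rho> p * \<beta>3 p) (\<lambda>p. s * \<rho> p * \<beta>4 p) p"
    unfolding p_def by (rule div_form_on_sphere)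
  have flux_diff: "flux3 \<beta>3 \<beta>4 differentiable at p" "flux4 \<beta>3 \<beta>4 differentiable at p"
    unfolding flux3_def[abs_def] flux4_def[abs_def]
    using smooth_diff[OF p] pd_\<beta>(1,2)[OF p] by simp_all
  have factor: "flux3 (\<lambda>p. s * \<rho> p * \<beta>3 p) (\<lambda>p. s * \<rho> p * \<beta>4 p) = (\<lambda>p. s * \<rho> p * flux3 \<beta>3 \<beta>4 p)"
    "flux4 (\<lambda>p. s * \<rho> p * \<beta>3 p) (\<lambda>p. s * \<rho> p * \<beta>4 p) = (\<lambda>p. s * \<rho> p * flux4 \<beta>3 \<beta>4 p)"
    by (auto simp: flux3_def flux4_def algebra_simps)
  have "m p * div_form (induced_metric g t r) (sphere_connection_form g \<tau> (e_r u) t r) q =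
    s * \<rho> p * (Dth (flux3 \<beta>3 \<beta>4) p + Dph (flux4 \<beta>3 \<beta>4) p
      - hld 3 (gbar a b c d e f u v) p * flux3 \<beta>3 \<beta>4 p - hld 4 (gbar a b c d e f u v) p * flux4 \<beta>3 \<beta>4 p)"
    unfolding div factor
    by (simp add: pd_mult pd_const flux_diff pd_\<rho>[OF p] differentiable_mult) (simp add: algebra_simps)
  also have "\<dots> = s * \<rho> p * (m p * operator d t r q)"
    using divergence_identity[OF p] m_operator[OF q smooth(4)] by (simp add: p_def)
  finally show ?thesis
    using pos(5)[OF p] by (simp add: s_def)
qed

lemma straight_out_iff:
  "straight_out g \<tau> D (e_r u) t r \<longleftrightarrow> (\<forall>q \<in> coord_sphere D t r. operator d t r q = 0)"
proof -
  have "sgn (\<tau> (sphere_pt t r q) $ 1) / 2 * \<rho> (sphere_pt t r q) \<noteq> 0" if "q \<in> coord_sphere D t r" for q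
  proof -
    have "sphere_pt t r q \<in> D" using that by (simp add: coord_sphere_def)
    then show ?thesis
      using pos[of "sphere_pt t r q"] time_component_nonzero by (simp add: \<rho>_def sgn_if)
  qed
  then show ?thesis
    unfolding straight_out_def by (auto simp: div_connection_form)
qed


section \<open>Ellipticity\<close>

text \<open>Apart from the explicit occurrences, the unknown enters through the logarithmic derivatives of
  the determinant, which is a quadratic polynomial in the unknown.\<close>

lemma F_term_cong_jet:
  assumes p: "p \<in> D" and w: "w differentiable at p" "w' differentiable at p"
    and jet: "w p = w' p" "Dth w p = Dth w' p" "Dph w p = Dph w' p"
  shows "F_term a b c w e f u v p = F_term a b c w' e f u v p"
proof -
  define P where "P q = - ((v q)\<^sup>2 * (u q)\<^sup>2 * m q)
    - (u q)\<^sup>2 * (b q * (e q)\<^sup>2 - 2 * c q * e q * f q + a q * (f q)\<^sup>2)" for q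
  have P: "P differentiable at p"
    unfolding P_def[abs_def] by (simp add: smooth_diff[OF p] coefficients_differentiable[OF p])
  have det: "det (gbar a b c y e f u v q) = P q - (y q)\<^sup>2 * m q" for y q
    unfolding det_gbar P_def m_def by simp
  have "pd i (\<lambda>q. det (gbar a b c y e f u v q)) p =
      pd i P p - (2 * y p * pd i y p * m p + (y p)\<^sup>2 * pd i m p)" if "y differentiable at p" for i y
    unfolding det using that P coefficients_differentiable(1)[OF p]
    by (simp add: pd_diff pd_mult pd_power2)
  then have "hld i (gbar a b c w e f u v) p = hld i (gbar a b c w' e f u v) p" if "i = 3 \<or> i = 4" for i
    using that w jet by (auto simp: hld_def det)
  then show ?thesis
    unfolding F_term_def Let_def by (simp add: jet)
qed

text \<open>The matrix \<open>C\<close> is the inverse of \<open>g\<^sub>S\<close>. The lower order part \<open>B\<close> must be a function of numbers, while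
  \<^const>\<open>G_term\<close> takes a function as its argument: the affine function with the prescribed value and
  derivatives serves as this argument.\<close>

lemma operator_elliptic: "second_order_elliptic_on_spheres D operator"
proof -
  define C :: "real^4 \<Rightarrow> real^2^2" where
    "C p = vector [vector [b p / m p, - c p / m p], vector [- c p / m p, a p / m p]]" for p
  define B :: "real^4 \<Rightarrow> real \<Rightarrow> real^2 \<Rightarrow> real" where
    "B p y \<xi> = ((Dth b p - Dph c p - cot (p $ 3) * b p) * \<xi> $ 1
        + (Dph a p - Dth c p + cot (p $ 3) * c p) * \<xi> $ 2) / m p
      + G_term a b c (\<lambda>z. y + \<xi> $ 1 * (z $ 3 - p $ 3) + \<xi> $ 2 * (z $ 4 - p $ 4)) e f u v p" for p y \<xi>
  have "ip (C p) \<xi> \<xi> > 0" if p: "p \<in> D" and \<xi>: "\<xi> \<noteq> 0" for p \<xi>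
  proof -
    have "a p * m p * ip (C p) \<xi> \<xi> = m p * (\<xi> $ 1)\<^sup>2 + (a p * \<xi> $ 2 - c p * \<xi> $ 1)\<^sup>2"
      using pos(5)[OF p]
      by (simp add: ip_def inner_vec_def matrix_vector_mult_def sum_2 C_def)
        (simp add: field_simps, simp add: m_def power2_eq_square algebra_simps)
    also have "\<dots> > 0"
    proof (cases "\<xi> $ 1 = 0")
      case True
      then have "\<xi> $ 2 \<noteq> 0" using \<xi> by (simp add: vec_eq_iff forall_2)
      then show ?thesis using True pos(3)[OF p] by simp
    next
      case False
      then show ?thesis using pos(4)[OF p] by (simp add: add_pos_nonneg)
    qed
    finally show ?thesis
      using mult_pos_pos[OF pos(3)[OF p] pos(4)[OF p]] zero_less_mult_pos by blast
  qed
  moreover have "operator w t r q = (\<Sum>i\<in>UNIV. \<Sum>j\<in>UNIV. C p $ i $ j * pd i (pd j ws) q)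
      + B p (w p) (\<chi> i. pd i ws q)"
    if w: "smooth_on D w" and q: "q \<in> coord_sphere D t r"
      and p_def: "p = sphere_pt t r q" and ws_def: "ws = (\<lambda>q. w (sphere_pt t r q))" for w t r q p ws
  proof -
    have p: "p \<in> D" using q by (simp add: coord_sphere_def p_def)
    note dw = smooth_on_differentiable[OF w] smooth_on_differentiable[OF smooth_on_pd[OF w]]
    have ws: "pd 1 ws y = Dth w (sphere_pt t r y)" "pd 2 ws y = Dph w (sphere_pt t r y)"
      if "y \<in> coord_sphere D t r" for y
      using that by (simp_all add: ws_def pd_on_sphere dw coord_sphere_def)
    have "pd i (pd 1 ws) q = pd i (\<lambda>y. Dth w (sphere_pt t r y)) q"
      "pd i (pd 2 ws) q = pd i (\<lambda>y. Dph w (sphere_pt t r y)) q" for i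
      by (rule pd_cong[OF open_coord_sphere[OF open_D] q], simp add: ws)+
    then have wss: "pd 1 (pd 1 ws) q = Dth (Dth w) p" "pd 2 (pd 1 ws) q = Dph (Dth w) p"
      "pd 1 (pd 2 ws) q = Dth (Dph w) p" "pd 2 (pd 2 ws) q = Dph (Dph w) p"
      using p by (simp_all add: pd_on_sphere dw p_def)
    \<comment> \<open>The affine function with the same value and first derivatives at \<open>p\<close> as \<open>w\<close>.\<close>
    define w' :: "real^4 \<Rightarrow> real" where "w' z = w p + Dth w p * (z $ 3 - p $ 3) + Dph w p * (z $ 4 - p $ 4)" for z
    have "F_term a b c w e f u v p = F_term a b c w' e f u v p"
      unfolding w'_def[abs_def]
      by (rule F_term_cong_jet[OF p])
        (simp_all add: dw p pd_add pd_mult pd_diff pd_const pd_component differentiable_component)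
    then have G: "G_term a b c w' e f u v p = F_term a b c w e f u v p / m p"
      using area[OF p] by (simp add: G_term_def m_def)
    have "operator w t r q = (m p * operator w t r q) / m p"
      using pos(5)[OF p] by simp
    also have "m p * operator w t r q = b p * Dth (Dth w) p - c p * Dth (Dph w) p - c p * Dph (Dth w) p
        + a p * Dph (Dph w) p
        + (Dth b p - Dph c p - cot (p $ 3) * b p) * Dth w p
        + (Dph a p - Dth c p + cot (p $ 3) * c p) * Dph w p + F_term a b c w e f u v p"
      unfolding p_def m_operator[OF q w] pd_flux[OF p[unfolded p_def] dw(2)[OF p[unfolded p_def]] dw(2)[OF p[unfolded p_def]]]
      by (simp add: flux3_def algebra_simps)
    finally show ?thesis
      by (simp add: sum_2 C_def B_def wss ws[OF q] flip: p_def)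
        (simp add: G[unfolded w'_def[abs_def]] add_divide_distrib diff_divide_distrib)
  qed
  ultimately show ?thesis
    unfolding second_order_elliptic_on_spheres_def Let_def by blast
qed

end

theorem proposition1p6:
  fixes M :: "'p topology"
    and A :: "'p chart set"
    and g :: "'p chart \<Rightarrow> real^4 \<Rightarrow> real^4^4"
    and T :: "'p chart \<Rightarrow> real^4 \<Rightarrow> real^4"
    and U :: "'p set" and x :: "'p \<Rightarrow> real^4"
    and a b c d e f u v :: "real^4 \<Rightarrow> real"
  assumes "spacetime M A g T"
    and "(U, x) \<in> A"
    and "smooth_on (x ` U) a" "smooth_on (x ` U) b" "smooth_on (x ` U) c" "smooth_on (x ` U) d"
    and "smooth_on (x ` U) e" "smooth_on (x ` U) f" "smooth_on (x ` U) u" "smooth_on (x ` U) v"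
    and "\<And>p. p \<in> x ` U \<Longrightarrow> g (U, x) p = gbar a b c d e f u v p"
    and "\<And>p. p \<in> x ` U \<Longrightarrow> a p * b p - (c p)\<^sup>2 = (p $ 2) ^ 4 * (sin (p $ 3))\<^sup>2"
    and "\<And>p. p \<in> x ` U \<Longrightarrow> sin (p $ 3) \<noteq> 0"
    and "\<And>p. p \<in> x ` U \<Longrightarrow> u p > 0"
    and "\<And>t r. spacelike_sphere (g (U, x)) (x ` U) t r"
  shows "((\<forall>t r. straight_out (g (U, x)) (T (U, x)) (x ` U) (e_r u) t r) \<longleftrightarrow>
          (\<forall>t r. \<forall>q \<in> coord_sphere (x ` U) t r.
             straight_out_operator (induced_metric (g (U, x))) a b c e f u v d t r q = 0))
         \<and> second_order_elliptic_on_spheres (x ` U)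
             (straight_out_operator (induced_metric (g (U, x))) a b c e f u v)"
proof -
  interpret spacetime M A g T by fact
  have sphere: "a p > 0 \<and> a p * b p - (c p)\<^sup>2 > 0" if p: "p \<in> x ` U" for p
  proof -
    obtain q where q: "p = sphere_pt (p $ 1) (p $ 2) q" using sphere_pt_exists by blast
    define h :: "real^2^2" where "h = vector [vector [a p, c p], vector [c p, b p]]"
    have "induced_metric (g (U, x)) (p $ 1) (p $ 2) q = h"
      using induced_gbar[of "g (U, x)" "p $ 1" "p $ 2" q a b c d e f u v] assms(11)[OF p]
      by (simp add: h_def flip: q)
    then have pd: "ip h X X > 0" if "X \<noteq> 0" for X
      using assms(15)[of "p $ 1" "p $ 2"] that p q unfolding spacelike_sphere_def coord_sphere_def
      by (metis mem_Collect_eq)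
    have ip: "ip h X X = a p * (X $ 1)\<^sup>2 + 2 * c p * X $ 1 * X $ 2 + b p * (X $ 2)\<^sup>2" for X
      by (simp add: ip_def inner_vec_def matrix_vector_mult_def sum_2 h_def)
        (simp add: power2_eq_square algebra_simps)
    have "a p > 0"
      using pd[of "axis 1 1"] by (simp add: ip axis_def vec_eq_iff)
    moreover have "a p * (a p * b p - (c p)\<^sup>2) > 0"
    proof -
      \<comment> \<open>The squared length of \<open>(- c, a)\<close>, which is orthogonal to \<open>\<partial>\<^sub>\<theta>\<close>, is \<open>a (a b - c\<^sup>2)\<close>.\<close>
      have "vector [- c p, a p] \<noteq> (0 :: real^2)"
        using \<open>a p > 0\<close> by (simp add: vec_eq_iff forall_2)
      from pd[OF this] show ?thesis
        by (simp add: ip) (simp add: power2_eq_square algebra_simps)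
    qed
    ultimately show ?thesis by (simp add: zero_less_mult_iff)
  qed
  interpret straight_out_chart "x ` U" "g (U, x)" "T (U, x)" a b c d e f u v
  proof
    show "open (x ` U)" using chart[OF assms(2)] by simp
    show "det (gbar a b c d e f u v p) < 0" if "p \<in> x ` U" for p
      using lorentzian_det_neg[OF metric_lorentzian[OF assms(2) that]] assms(11)[OF that] by simp
    show "continuous_on (x ` U) (T (U, x))" by (rule time_continuous[OF assms(2)])
    show "ip (g (U, x) p) (T (U, x) p) (T (U, x) p) < 0" if "p \<in> x ` U" for p
      by (rule time_timelike[OF assms(2) that])
  qed (use assms sphere in auto)
  show ?thesis
    using straight_out_iff operator_elliptic unfolding operator_def by blast
qed

end
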